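(* Let $G$ be a periodic group such that $H_iH_j=H_jH_i$ for all minimal subgroups $H_i,H_j$ of $G$, and such that $G$ has at least two minimal subgroups. Suppose that either $G$ is not a $p$-group for any prime $p$, or $G$ is a $p$-group with $|\Omega(G)|>p^2$ for some prime $p$. Then for any group $\widetilde G$, $\mathcal K_1(G)\cong\mathcal K_1(\widetilde G)$ (as semigroups) if and only if $G\cong\widetilde G$ (as groups).
   Context: For a group $G$, $K\le G$ and $g\in G$, write $K^g=g^{-1}Kg$. $\mathcal K_1(G)$ denotes the set of all right cosets $Ha$ ($a\in G$) of all non-trivial subgroups $H$ of $G$, equipped with the operation $Ha*Kb=\langle H,K^{a^{-1}}\rangle ab$; it is an inverse semigroup. A minimal subgroup is a minimal non-trivial subgroup (necessarily of prime order). For a prime $p$, $\Omega_p(G)=\langle x\in G\mid x^p=1\rangle$ is the subgroup generated by all minimal subgroups of order $p$, and $\Omega(G)=\prod_{p}\Omega_p(G)$ (the subgroup generated by all $\Omega_p(G)$, $p$ prime); if $G$ is a $p$-group then $\Omega(G)=\Omega_p(G)$. Groups may be infinite; a $p$-group is a group in which every element has order a power of $p$. *)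

theory Defs
  imports "HOL-Algebra.Algebra" "HOL-Computational_Algebra.Primes"
begin

definition nontrivial_subgroup :: "'a set \<Rightarrow> ('a, 'm) monoid_scheme \<Rightarrow> bool" where
  "nontrivial_subgroup H G \<longleftrightarrow> subgroup H G \<and> H \<noteq> {\<one>\<^bsub>G\<^esub>}"

definition minimal_subgroup :: "'a set \<Rightarrow> ('a, 'm) monoid_scheme \<Rightarrow> bool" where
  "minimal_subgroup H G \<longleftrightarrow> nontrivial_subgroup H G \<and>
     (\<forall>K. nontrivial_subgroup K G \<and> K \<subseteq> H \<longrightarrow> K = H)"

definition periodic_group :: "('a, 'm) monoid_scheme \<Rightarrow> bool" where
  "periodic_group G \<longleftrightarrow> group G \<and> (\<forall>x\<in>carrier G. \<exists>n::nat. n > 0 \<and> x [^]\<^bsub>G\<^esub> n = \<one>\<^bsub>G\<^esub>)"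

text \<open>Elements of infinite order have \<open>group.ord\<close> equal to 0, which is not a power of a prime.\<close>

definition p_group :: "nat \<Rightarrow> ('a, 'm) monoid_scheme \<Rightarrow> bool" where
  "p_group p G \<longleftrightarrow> group G \<and> Factorial_Ring.prime p \<and> (\<forall>x\<in>carrier G. \<exists>k::nat. group.ord G x = p ^ k)"

definition Omega_p :: "nat \<Rightarrow> ('a, 'm) monoid_scheme \<Rightarrow> 'a set" where
  "Omega_p p G = generate G {x \<in> carrier G. x [^]\<^bsub>G\<^esub> p = \<one>\<^bsub>G\<^esub>}"

definition Omega :: "('a, 'm) monoid_scheme \<Rightarrow> 'a set" where
  "Omega G = generate G (\<Union>p\<in>{p. Factorial_Ring.prime p}. Omega_p p G)"

definition conj_set :: "('a, 'm) monoid_scheme \<Rightarrow> 'a set \<Rightarrow> 'a \<Rightarrow> 'a set" where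
  "conj_set G K g = (inv\<^bsub>G\<^esub> g <#\<^bsub>G\<^esub> K) #>\<^bsub>G\<^esub> g"

definition K1_set :: "('a, 'm) monoid_scheme \<Rightarrow> 'a set set" where
  "K1_set G = {H #>\<^bsub>G\<^esub> a |H a. nontrivial_subgroup H G \<and> a \<in> carrier G}"

text \<open>The defining formula refers to representations \<open>A = Ha\<close> and \<open>B = Kb\<close>; its value does not
  depend on the chosen ones, see \<open>K1_mult_coset\<close>.\<close>

definition K1_mult :: "('a, 'm) monoid_scheme \<Rightarrow> 'a set \<Rightarrow> 'a set \<Rightarrow> 'a set" where
  "K1_mult G A B = (THE C. \<exists>H K a b.
     nontrivial_subgroup H G \<and> nontrivial_subgroup K G \<and> a \<in> carrier G \<and> b \<in> carrier G \<and>
     A = H #>\<^bsub>G\<^esub> a \<and> B = K #>\<^bsub>G\<^esub> b \<and>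
     C = generate G (H \<union> conj_set G K (inv\<^bsub>G\<^esub> a)) #>\<^bsub>G\<^esub> (a \<otimes>\<^bsub>G\<^esub> b))"

text \<open>The semigroup is packaged as a monoid record in order to use the library's \<open>\<cong>\<close>, which only
  involves the carrier and the multiplication. The field \<open>one\<close> is a dummy: there need not be an
  identity element.\<close>

definition K1 :: "('a, 'm) monoid_scheme \<Rightarrow> 'a set monoid" where
  "K1 G = \<lparr>carrier = K1_set G, monoid.mult = K1_mult G, one = undefined\<rparr>"

context group
begin

lemma conj_set_subset:
  assumes "K \<subseteq> carrier G" "g \<in> carrier G"
  shows "conj_set G K g \<subseteq> carrier G"
  using assms by (auto simp: conj_set_def l_coset_def r_coset_def)

lemma inv_cancel:
  assumes "x \<in> carrier G" "y \<in> carrier G"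
  shows "inv x \<otimes> (x \<otimes> y) = y"
  using assms by (simp add: m_assoc [symmetric])

text \<open>The product of two cosets is the least coset containing their elementwise product.\<close>

lemma K1_product_least:
  assumes H: "subgroup H G" and K: "subgroup K G" and a: "a \<in> carrier G" and b: "b \<in> carrier G"
  shows "generate G (H \<union> conj_set G K (inv a)) #> (a \<otimes> b) =
    \<Inter>{L #> c |L c. subgroup L G \<and> c \<in> carrier G \<and> (H #> a) <#> (K #> b) \<subseteq> L #> c}"
    (is "?M #> _ = \<Inter>?S")
proof
  have HG: "H \<subseteq> carrier G" and KG: "K \<subseteq> carrier G"
    using H K by (auto dest: subgroup.subset)
  have gen: "H \<union> conj_set G K (inv a) \<subseteq> carrier G"
    using HG conj_set_subset[OF KG] a by auto
  have M: "subgroup ?M G" using generate_is_subgroup[OF gen] .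
  have inM: "h \<in> ?M" if "h \<in> H \<union> conj_set G K (inv a)" for h
    using that by (rule generate.incl)
  have conjI': "a \<otimes> k \<otimes> inv a \<in> conj_set G K (inv a)" if "k \<in> K" for k
    using that a by (auto simp: conj_set_def l_coset_def r_coset_def)
  have "(H #> a) <#> (K #> b) \<subseteq> ?M #> (a \<otimes> b)"
  proof
    fix x assume "x \<in> (H #> a) <#> (K #> b)"
    then obtain h k where hk: "h \<in> H" "k \<in> K" and x: "x = (h \<otimes> a) \<otimes> (k \<otimes> b)"
      by (auto simp: set_mult_def r_coset_def)
    have c: "h \<in> carrier G" "k \<in> carrier G" using hk HG KG by auto
    have "x = (h \<otimes> (a \<otimes> k \<otimes> inv a)) \<otimes> (a \<otimes> b)"
      using c a b x by (simp add: m_assoc inv_cancel)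
    moreover have "h \<otimes> (a \<otimes> k \<otimes> inv a) \<in> ?M"
      using subgroup.m_closed[OF M inM inM, of h "a \<otimes> k \<otimes> inv a"] hk conjI' by simp
    ultimately show "x \<in> ?M #> (a \<otimes> b)" by (auto simp: r_coset_def)
  qed
  then show "\<Inter>?S \<subseteq> ?M #> (a \<otimes> b)" using M a b by blast
  show "?M #> (a \<otimes> b) \<subseteq> \<Inter>?S"
  proof (rule Inter_greatest)
    fix Y assume "Y \<in> ?S"
    then obtain L c where L: "subgroup L G" and c: "c \<in> carrier G" and Y: "Y = L #> c"
      and sub: "(H #> a) <#> (K #> b) \<subseteq> L #> c" by blast
    have mem: "(h \<otimes> a) \<otimes> (k \<otimes> b) \<in> L #> c" if "h \<in> H" "k \<in> K" for h k
      using sub that by (auto simp: set_mult_def r_coset_def)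
    have "a \<otimes> b \<in> L #> c"
      using mem[OF subgroup.one_closed[OF H] subgroup.one_closed[OF K]] a b by simp
    then have Lc: "L #> c = L #> (a \<otimes> b)" using repr_independence[OF _ c L] by simp
    have cancel: "y \<in> L" if yc: "y \<otimes> (a \<otimes> b) \<in> L #> c" and y: "y \<in> carrier G" for y
    proof -
      obtain l where l: "l \<in> L" "y \<otimes> (a \<otimes> b) = l \<otimes> (a \<otimes> b)"
        using yc unfolding Lc by (auto simp: r_coset_def)
      then have "y = l" using y a b subgroup.mem_carrier[OF L] by simp
      then show ?thesis using l by simp
    qed
    have "h \<in> L" if "h \<in> H" for h
      using cancel[of h] mem[OF that subgroup.one_closed[OF K]] that HG a b
      by (auto simp: m_assoc)
    moreover have "y \<in> L" if yK: "y \<in> conj_set G K (inv a)" for y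
    proof -
      obtain k where k: "k \<in> K" and y: "y = a \<otimes> k \<otimes> inv a"
        using yK a by (auto simp: conj_set_def l_coset_def r_coset_def)
      have kc: "k \<in> carrier G" using k KG by auto
      have "y \<otimes> (a \<otimes> b) = a \<otimes> (k \<otimes> b)"
        using kc a b y by (simp add: m_assoc inv_cancel)
      then show ?thesis
        using cancel[of y] mem[OF subgroup.one_closed[OF H] k] kc a b y by simp
    qed
    ultimately have "?M \<subseteq> L" using generate_subgroup_incl[OF _ L] by blast
    then show "?M #> (a \<otimes> b) \<subseteq> Y" unfolding Y Lc by (auto simp: r_coset_def)
  qed
qed

lemma K1_mult_coset:
  assumes "nontrivial_subgroup H G" "nontrivial_subgroup K G" "a \<in> carrier G" "b \<in> carrier G"
  shows "K1_mult G (H #> a) (K #> b) = generate G (H \<union> conj_set G K (inv a)) #> (a \<otimes> b)"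
  unfolding K1_mult_def
proof (rule the_equality)
  show "\<exists>H' K' a' b'. nontrivial_subgroup H' G \<and> nontrivial_subgroup K' G \<and>
     a' \<in> carrier G \<and> b' \<in> carrier G \<and> H #> a = H' #> a' \<and> K #> b = K' #> b' \<and>
     generate G (H \<union> conj_set G K (inv a)) #> (a \<otimes> b) =
     generate G (H' \<union> conj_set G K' (inv a')) #> (a' \<otimes> b')"
    using assms by blast
next
  fix C
  assume "\<exists>H' K' a' b'. nontrivial_subgroup H' G \<and> nontrivial_subgroup K' G \<and>
     a' \<in> carrier G \<and> b' \<in> carrier G \<and> H #> a = H' #> a' \<and> K #> b = K' #> b' \<and>
     C = generate G (H' \<union> conj_set G K' (inv a')) #> (a' \<otimes> b')"
  then obtain H' K' a' b' where *: "nontrivial_subgroup H' G" "nontrivial_subgroup K' G"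
     "a' \<in> carrier G" "b' \<in> carrier G" "H #> a = H' #> a'" "K #> b = K' #> b'"
     "C = generate G (H' \<union> conj_set G K' (inv a')) #> (a' \<otimes> b')" by blast
  then show "C = generate G (H \<union> conj_set G K (inv a)) #> (a \<otimes> b)"
    using assms K1_product_least[of H K a b] K1_product_least[of H' K' a' b']
    unfolding nontrivial_subgroup_def by simp
qed

lemma K1_mult_closed:
  assumes "A \<in> K1_set G" "B \<in> K1_set G"
  shows "K1_mult G A B \<in> K1_set G"
proof -
  obtain H a K b where *: "nontrivial_subgroup H G" "nontrivial_subgroup K G"
     "a \<in> carrier G" "b \<in> carrier G" "A = H #> a" "B = K #> b"
    using assms unfolding K1_set_def by blast
  let ?M = "generate G (H \<union> conj_set G K (inv a))"
  have H: "subgroup H G" and K: "subgroup K G" and Hn: "H \<noteq> {\<one>}"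
    using * by (auto simp: nontrivial_subgroup_def)
  have "subgroup ?M G"
    using * conj_set_subset[OF subgroup.subset[OF K]] subgroup.subset[OF H]
    by (intro generate_is_subgroup) auto
  moreover have "H \<subseteq> ?M" by (auto intro: generate.incl)
  then have "?M \<noteq> {\<one>}" using Hn subgroup.one_closed[OF H] by blast
  ultimately have "nontrivial_subgroup ?M G" by (simp add: nontrivial_subgroup_def)
  then show ?thesis
    using * K1_mult_coset[OF *(1-4)] unfolding K1_set_def by auto
qed

end

end

theory Submission
  imports Defs
begin

text \<open>Let \<open>\<phi> : K\<^sub>1(G) \<rightarrow> K\<^sub>1(G')\<close> be an isomorphism. It maps subgroups to subgroups, preserves inclusion of
  cosets, and maps the cosets of \<open>H\<close> onto the cosets of \<open>\<phi>(H)\<close>. If \<open>H \<noteq> K\<close> are minimal, the larger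
  of them is normal in \<open>H K\<close>, and \<open>\<phi>\<close> preserves this, so that \<open>\<phi>(H K) = \<phi>(H) \<phi>(K)\<close>. Hence the cosets
  \<open>\<phi>(H a)\<close> and \<open>\<phi>(K a)\<close> meet in exactly one point. The assumptions on \<open>G\<close> guarantee that there are
  enough minimal subgroups for this point \<open>\<theta>(a)\<close> not to depend on \<open>H\<close> and \<open>K\<close>. Finally, \<open>\<theta>\<close> is an
  isomorphism: \<open>\<theta>(a) \<theta>(b)\<close> lies in \<open>\<phi>(H a) * \<phi>(H\<^sup>a b) = \<phi>(H a b)\<close> for every minimal \<open>H\<close>.\<close>

section \<open>Cosets and products of permuting subgroups\<close>

context group
begin

lemma nontrivial_subgroup_carrier: "nontrivial_subgroup H G \<Longrightarrow> H \<subseteq> carrier G"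
  by (simp add: nontrivial_subgroup_def subgroup.subset)

lemma nontrivial_subgroup_imp_subgroup: "nontrivial_subgroup H G \<Longrightarrow> subgroup H G"
  by (simp add: nontrivial_subgroup_def)

lemma nontrivial_subgroup_ex: "nontrivial_subgroup H G \<Longrightarrow> \<exists>x\<in>H. x \<noteq> \<one>"
  unfolding nontrivial_subgroup_def using subgroup.one_closed by fastforce

lemma nontrivial_subgroup_mono:
  assumes "nontrivial_subgroup H G" "subgroup K G" "H \<subseteq> K"
  shows "nontrivial_subgroup K G"
  using nontrivial_subgroup_ex[OF assms(1)] assms by (auto simp: nontrivial_subgroup_def)

lemma mem_r_coset_iff:
  assumes "subgroup H G" "a \<in> carrier G" "x \<in> carrier G"
  shows "x \<in> H #> a \<longleftrightarrow> x \<otimes> inv a \<in> H"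
proof
  assume "x \<in> H #> a"
  then obtain h where "h \<in> H" "x = h \<otimes> a" by (auto simp: r_coset_def)
  then show "x \<otimes> inv a \<in> H"
    using assms by (simp add: m_assoc subgroup.mem_carrier)
next
  assume "x \<otimes> inv a \<in> H"
  moreover have "x = (x \<otimes> inv a) \<otimes> a" using assms by (simp add: m_assoc)
  ultimately show "x \<in> H #> a" unfolding r_coset_def by blast
qed

lemma r_coset_subset_iff:
  assumes H: "subgroup H G" and K: "subgroup K G" and a: "a \<in> carrier G" and b: "b \<in> carrier G"
  shows "H #> a \<subseteq> K #> b \<longleftrightarrow> H \<subseteq> K \<and> a \<in> K #> b"
proof
  assume sub: "H #> a \<subseteq> K #> b"
  then have aK: "a \<in> K #> b" using rcos_self[OF a H] by blast
  then have "K #> b = K #> a" using repr_independence b K by blast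
  then have "h \<in> K" if "h \<in> H" for h
    using sub that mem_r_coset_iff[OF K a, of "h \<otimes> a"] rcosI[OF that subgroup.subset[OF H] a]
      subgroup.mem_carrier[OF H that] a by (auto simp: m_assoc)
  then show "H \<subseteq> K \<and> a \<in> K #> b" using aK by blast
next
  assume r: "H \<subseteq> K \<and> a \<in> K #> b"
  then have "K #> b = K #> a" using repr_independence b K by blast
  then show "H #> a \<subseteq> K #> b" using r by (auto simp: r_coset_def)
qed

lemma r_coset_eq_imp_eq:
  assumes "subgroup H G" "subgroup K G" "a \<in> carrier G" "b \<in> carrier G" "H #> a = K #> b"
  shows "H = K"
  using assms r_coset_subset_iff[of H K a b] r_coset_subset_iff[of K H b a] by auto

lemma r_coset_one: "subgroup H G \<Longrightarrow> H #> \<one> = H"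
  by (simp add: subgroup.subset)

lemma conj_set_eq: "conj_set G K g = (\<lambda>k. inv g \<otimes> k \<otimes> g) ` K"
  by (auto simp: conj_set_def l_coset_def r_coset_def)

lemma conj_set_one: "K \<subseteq> carrier G \<Longrightarrow> conj_set G K \<one> = K"
  unfolding conj_set_eq by (subst image_cong[OF refl, of K _ id]) auto

lemma generate_subgroup_eq: "subgroup H G \<Longrightarrow> generate G H = H"
  using generate_subgroup_incl[of H H] by (auto intro: generate.incl)

lemma subgroup_set_mult:
  assumes H: "subgroup H G" and K: "subgroup K G" and comm: "H <#> K = K <#> H"
  shows "subgroup (H <#> K) G"
proof (rule subgroupI)
  have HG: "H \<subseteq> carrier G" and KG: "K \<subseteq> carrier G" using H K by (auto dest: subgroup.subset)
  show "H <#> K \<subseteq> carrier G" using HG KG by (rule set_mult_closed)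
  show "H <#> K \<noteq> {}"
    using subgroup.one_closed[OF H] subgroup.one_closed[OF K] by (auto simp: set_mult_def)
  show "inv x \<in> H <#> K" if "x \<in> H <#> K" for x
  proof -
    obtain h k where *: "h \<in> H" "k \<in> K" "x = h \<otimes> k" using \<open>x \<in> H <#> K\<close> by (auto simp: set_mult_def)
    then have "inv x = inv k \<otimes> inv h" using HG KG by (simp add: inv_mult_group subset_iff)
    then have "inv x \<in> K <#> H"
      using * H K by (auto simp: set_mult_def intro: subgroup.m_inv_closed)
    then show ?thesis using comm by simp
  qed
  have "(H <#> K) <#> (H <#> K) = H <#> (K <#> H) <#> K"
    using HG KG by (simp add: set_mult_assoc set_mult_closed)
  also have "\<dots> = (H <#> H) <#> (K <#> K)"
    using HG KG by (simp flip: comm add: set_mult_assoc set_mult_closed)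
  also have "\<dots> = H <#> K" using H K by (simp add: subgroup_mult_id)
  finally have idem: "(H <#> K) <#> (H <#> K) = H <#> K" .
  show "x \<otimes> y \<in> H <#> K" if "x \<in> H <#> K" "y \<in> H <#> K" for x y
  proof -
    have "x \<otimes> y \<in> (H <#> K) <#> (H <#> K)" using that unfolding set_mult_def[of G "H <#> K"] by blast
    then show ?thesis unfolding idem .
  qed
qed

lemma subset_set_mult:
  assumes "subgroup H G" "subgroup K G"
  shows "H \<subseteq> H <#> K" "K \<subseteq> H <#> K"
proof -
  have "h = h \<otimes> \<one>" if "h \<in> H" for h using that assms by (simp add: subgroup.mem_carrier)
  then show "H \<subseteq> H <#> K" using subgroup.one_closed[OF assms(2)] by (force simp: set_mult_def)
  have "k = \<one> \<otimes> k" if "k \<in> K" for k using that assms by (simp add: subgroup.mem_carrier)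
  then show "K \<subseteq> H <#> K" using subgroup.one_closed[OF assms(1)] by (force simp: set_mult_def)
qed

lemma set_mult_subset_subgroup:
  assumes "subgroup M G" "H \<subseteq> M" "K \<subseteq> M"
  shows "H <#> K \<subseteq> M"
  using assms by (auto simp: set_mult_def intro: subgroup.m_closed)

lemma generate_Un_eq_set_mult:
  assumes H: "subgroup H G" and K: "subgroup K G" and comm: "H <#> K = K <#> H"
  shows "generate G (H \<union> K) = H <#> K"
proof
  show "generate G (H \<union> K) \<subseteq> H <#> K"
    using subset_set_mult[OF H K] by (intro generate_subgroup_incl subgroup_set_mult assms) auto
  have "subgroup (generate G (H \<union> K)) G"
    using H K by (intro generate_is_subgroup) (auto dest: subgroup.subset)
  then show "H <#> K \<subseteq> generate G (H \<union> K)"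
    by (rule set_mult_subset_subgroup) (auto intro: generate.incl)
qed

text \<open>Moving \<open>h\<close> past \<open>k\<close> costs only a conjugation:
  \<open>h k = (h k h^-1) h\<close> and \<open>k h = h (h^-1 k h)\<close>.\<close>

lemma set_mult_commute_if_normalizes:
  assumes H: "subgroup H G" and K: "subgroup K G"
    and norm: "\<And>h k. h \<in> H \<Longrightarrow> k \<in> K \<Longrightarrow> h \<otimes> k \<otimes> inv h \<in> K"
  shows "H <#> K = K <#> H"
proof
  note HG = subgroup.mem_carrier[OF H] and KG = subgroup.mem_carrier[OF K]
  have "h \<otimes> k \<in> K <#> H" if "h \<in> H" "k \<in> K" for h k
  proof -
    have "h \<otimes> k = (h \<otimes> k \<otimes> inv h) \<otimes> h" using that HG KG by (simp add: m_assoc)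
    then show ?thesis using norm that by (auto simp: set_mult_def)
  qed
  then show "H <#> K \<subseteq> K <#> H" by (auto simp: set_mult_def)
  have "k \<otimes> h \<in> H <#> K" if "h \<in> H" "k \<in> K" for h k
  proof -
    have "k \<otimes> h = h \<otimes> (inv h \<otimes> k \<otimes> inv (inv h))" using that HG KG
      by (simp add: m_assoc) (simp flip: m_assoc)
    then show ?thesis using norm[of "inv h" k] subgroup.m_inv_closed[OF H] that
      unfolding set_mult_def by blast
  qed
  then show "K <#> H \<subseteq> H <#> K" by (auto simp: set_mult_def)
qed

text \<open>The quotient of two common points lies in both \<open>H\<close> and \<open>K\<close>.
  This yields uniqueness of the point assigned to \<open>a\<close>, and later injectivity of the
  resulting map.\<close>

lemma r_cosets_Int:
  assumes H: "subgroup H G" and K: "subgroup K G" and Int: "H \<inter> K = {\<one>}"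
    and "a \<in> carrier G" "b \<in> carrier G"
    and "x \<in> (H #> a) \<inter> (K #> b)" "y \<in> (H #> a) \<inter> (K #> b)"
  shows "x = y"
proof -
  have c: "x \<in> carrier G" "y \<in> carrier G"
    using assms r_coset_subset_G subgroup.subset by blast+
  have "x \<in> H #> y" "x \<in> K #> y"
    using assms repr_independence[of y H a] repr_independence[of y K b] by auto
  then have "x \<otimes> inv y \<in> H \<inter> K" using c mem_r_coset_iff H K by simp
  then have "x \<otimes> inv y = \<one>" using Int by simp
  then show ?thesis using c by (metis inv_equality inv_closed inv_inv)
qed

text \<open>Existence counterpart of \<open>r_cosets_Int\<close>: representatives in one coset of
  \<open>H K\<close> satisfy \<open>x y^-1 = h k\<close>, so \<open>h^-1 x = k y\<close> is a common
  point.\<close>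

lemma r_cosets_meet:
  assumes H: "subgroup H G" and K: "subgroup K G" and comm: "H <#> K = K <#> H"
    and x: "x \<in> carrier G" and y: "y \<in> carrier G" and z: "z \<in> carrier G"
    and "x \<in> (H <#> K) #> z" "y \<in> (H <#> K) #> z"
  shows "\<exists>c\<in>carrier G. c \<in> H #> x \<and> c \<in> K #> y"
proof -
  have M: "subgroup (H <#> K) G" by (rule subgroup_set_mult[OF H K comm])
  have "x \<in> (H <#> K) #> y" using assms repr_independence[OF _ z M] by auto
  then have "x \<otimes> inv y \<in> H <#> K" using mem_r_coset_iff[OF M y x] by simp
  then obtain h k where hk: "h \<in> H" "k \<in> K" "x \<otimes> inv y = h \<otimes> k" by (auto simp: set_mult_def)
  have c: "h \<in> carrier G" "k \<in> carrier G"
    using hk subgroup.mem_carrier[OF H] subgroup.mem_carrier[OF K] by auto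
  have "x = h \<otimes> (k \<otimes> y)" using hk c x y by (metis inv_solve_right' m_assoc m_closed)
  then have "inv h \<otimes> x = k \<otimes> y" using c y by (simp add: inv_cancel)
  moreover have "inv h \<otimes> x \<in> H #> x" using hk H x
    by (simp add: rcosI subgroup.m_inv_closed subgroup.subset)
  moreover have "k \<otimes> y \<in> K #> y" using hk K y by (simp add: rcosI subgroup.subset)
  ultimately show ?thesis using c y by (intro bexI[of _ "k \<otimes> y"]) auto
qed

section \<open>The semigroup of cosets: representatives, products, idempotents and order\<close>

lemma K1_setI: "nontrivial_subgroup H G \<Longrightarrow> a \<in> carrier G \<Longrightarrow> H #> a \<in> K1_set G"
  by (auto simp: K1_set_def)

lemma subgroup_in_K1_set: "nontrivial_subgroup H G \<Longrightarrow> H \<in> K1_set G"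
  using K1_setI[of H \<one>] by (simp add: r_coset_one nontrivial_subgroup_imp_subgroup)

lemma K1_setE:
  assumes "A \<in> K1_set G"
  obtains H a where "nontrivial_subgroup H G" "a \<in> carrier G" "A = H #> a"
  using assms unfolding K1_set_def by blast

lemma K1_setE_mem:
  assumes "A \<in> K1_set G" "x \<in> A"
  obtains H where "nontrivial_subgroup H G" "x \<in> carrier G" "A = H #> x"
proof -
  obtain H a where *: "nontrivial_subgroup H G" "a \<in> carrier G" "A = H #> a"
    using assms by (auto elim: K1_setE)
  then have H: "subgroup H G" by (simp add: nontrivial_subgroup_def)
  have "A = H #> x" using * assms repr_independence[OF _ _ H] by blast
  moreover have "x \<in> carrier G" using * assms r_coset_subset_G[OF subgroup.subset[OF H]] by blast
  ultimately show ?thesis using * that by blast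
qed

lemma K1_product_subgroup:
  assumes "nontrivial_subgroup H G" "nontrivial_subgroup K G" "a \<in> carrier G"
  shows "nontrivial_subgroup (generate G (H \<union> conj_set G K (inv a))) G"
proof (rule nontrivial_subgroup_mono[OF assms(1)])
  show "subgroup (generate G (H \<union> conj_set G K (inv a))) G"
    using assms by (intro generate_is_subgroup Un_least conj_set_subset nontrivial_subgroup_carrier) auto
qed (auto intro: generate.incl)

text \<open>Any elements of two cosets can serve as their representatives, and then
  \<open>x \<otimes> y\<close> represents the product coset. This turns equations between cosets
  into statements about elements.\<close>

lemma mult_mem_K1_mult:
  assumes "A \<in> K1_set G" "B \<in> K1_set G" "x \<in> A" "y \<in> B"
  shows "x \<otimes> y \<in> K1_mult G A B"
proof -
  obtain H where H: "nontrivial_subgroup H G" "x \<in> carrier G" "A = H #> x"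
    using K1_setE_mem[OF assms(1,3)] .
  obtain K where K: "nontrivial_subgroup K G" "y \<in> carrier G" "B = K #> y"
    using K1_setE_mem[OF assms(2,4)] .
  show ?thesis using H K K1_product_subgroup[of H K x]
    by (simp add: K1_mult_coset rcos_self nontrivial_subgroup_def)
qed

text \<open>Left multiplication by an idempotent enlarges the subgroup and keeps the representative,
  because \<open>E\<close> has the representative \<open>\<one>\<close>, by which conjugation is
  trivial.\<close>

lemma K1_mult_subgroup_coset:
  assumes "nontrivial_subgroup E G" "nontrivial_subgroup H G" "a \<in> carrier G"
  shows "K1_mult G E (H #> a) = generate G (E \<union> H) #> a"
  using K1_mult_coset[OF assms(1,2) one_closed assms(3)] assms
  by (simp add: nontrivial_subgroup_def r_coset_one conj_set_one subgroup.subset)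

lemma K1_mult_subgroups:
  assumes "nontrivial_subgroup H G" "nontrivial_subgroup K G"
  shows "K1_mult G H K = generate G (H \<union> K)"
proof -
  have "subgroup (generate G (H \<union> K)) G"
    using assms by (intro generate_is_subgroup) (auto dest: nontrivial_subgroup_carrier)
  then show ?thesis
    using K1_mult_subgroup_coset[OF assms one_closed] assms
    by (simp add: r_coset_one nontrivial_subgroup_imp_subgroup)
qed

text \<open>If \<open>A = H a\<close> is idempotent, then \<open>a a\<close> lies in
  \<open>H a\<close>, which forces \<open>a \<in> H\<close>. Thus the subgroups can be recognized
  inside the semigroup.\<close>

lemma K1_mult_idem_iff:
  assumes "A \<in> K1_set G"
  shows "K1_mult G A A = A \<longleftrightarrow> nontrivial_subgroup A G"
proof
  obtain H a where *: "nontrivial_subgroup H G" "a \<in> carrier G" "A = H #> a"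
    using assms by (auto elim: K1_setE)
  then have H: "subgroup H G" by (simp add: nontrivial_subgroup_def)
  assume idem: "K1_mult G A A = A"
  have "a \<in> A" using * H by (simp add: rcos_self)
  then have "a \<otimes> a \<in> H #> a" using mult_mem_K1_mult[OF assms assms] idem * by auto
  then have "a \<in> H" using mem_r_coset_iff[OF H] * by (simp add: m_assoc)
  then show "nontrivial_subgroup A G" using * H by (simp add: coset_join2)
next
  assume "nontrivial_subgroup A G"
  then show "K1_mult G A A = A"
    by (simp add: K1_mult_subgroups generate_subgroup_eq nontrivial_subgroup_imp_subgroup)
qed

text \<open>Inclusion of cosets is the natural partial order of the inverse semigroup, reversed; being
  definable from the multiplication, it is preserved by isomorphisms.\<close>

lemma K1_subset_iff:
  assumes "A \<in> K1_set G" "B \<in> K1_set G"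
  shows "B \<subseteq> A \<longleftrightarrow> (\<exists>E\<in>K1_set G. K1_mult G E E = E \<and> A = K1_mult G E B)"
proof
  assume BA: "B \<subseteq> A"
  obtain K b where K: "nontrivial_subgroup K G" "b \<in> carrier G" "B = K #> b"
    using assms by (auto elim: K1_setE)
  have "b \<in> A" using BA K rcos_self nontrivial_subgroup_imp_subgroup by blast
  then obtain H where H: "nontrivial_subgroup H G" "A = H #> b"
    using K1_setE_mem[OF assms(1)] by blast
  have "K \<subseteq> H" using BA H K r_coset_subset_iff nontrivial_subgroup_imp_subgroup by blast
  \<comment> \<open>The witness is the subgroup of which \<open>A\<close> is a coset: as
    \<open>K \<subseteq> H\<close>, multiplying \<open>K b\<close> by \<open>H\<close> gives
    \<open>H b\<close>.\<close>
  then have "A = K1_mult G H B"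
    using H K by (simp add: K1_mult_subgroup_coset generate_subgroup_eq sup_absorb1
        nontrivial_subgroup_imp_subgroup)
  then show "\<exists>E\<in>K1_set G. K1_mult G E E = E \<and> A = K1_mult G E B"
    using H subgroup_in_K1_set K1_mult_idem_iff by blast
next
  assume "\<exists>E\<in>K1_set G. K1_mult G E E = E \<and> A = K1_mult G E B"
  then obtain E where E: "nontrivial_subgroup E G" "A = K1_mult G E B"
    using K1_mult_idem_iff by blast
  obtain K b where K: "nontrivial_subgroup K G" "b \<in> carrier G" "B = K #> b"
    using assms by (auto elim: K1_setE)
  have "A = generate G (E \<union> K) #> b" using E K by (simp add: K1_mult_subgroup_coset)
  then show "B \<subseteq> A" using K by (auto simp: r_coset_def intro: generate.incl)
qed

end

section \<open>What a semigroup isomorphism preserves, for arbitrary groups\<close>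

locale K1_iso = G: group G + G': group G'
  for G :: "('a, 'm) monoid_scheme" (structure) and G' :: "('b, 'n) monoid_scheme" +
  fixes \<phi> :: "'a set \<Rightarrow> 'b set"
  assumes iso: "\<phi> \<in> iso (K1 G) (K1 G')"
begin

lemma phi_image: "\<phi> ` K1_set G = K1_set G'"
  using iso by (simp add: iso_def bij_betw_def K1_def)

lemma phi_closed: "A \<in> K1_set G \<Longrightarrow> \<phi> A \<in> K1_set G'"
  by (subst phi_image[symmetric]) (rule imageI)

lemma phi_surj: "B \<in> K1_set G' \<Longrightarrow> \<exists>A\<in>K1_set G. \<phi> A = B"
  unfolding phi_image[symmetric] by blast

lemma phi_inj_on: "inj_on \<phi> (K1_set G)"
  using iso by (simp add: iso_def bij_betw_def K1_def)

lemma phi_inj: "A \<in> K1_set G \<Longrightarrow> B \<in> K1_set G \<Longrightarrow> \<phi> A = \<phi> B \<longleftrightarrow> A = B"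
  by (rule inj_on_eq_iff[OF phi_inj_on])

lemma phi_mult:
  "A \<in> K1_set G \<Longrightarrow> B \<in> K1_set G \<Longrightarrow> \<phi> (K1_mult G A B) = K1_mult G' (\<phi> A) (\<phi> B)"
  using iso hom_mult[of \<phi> "K1 G" "K1 G'" A B] by (simp add: iso_def K1_def)

lemma phi_nontrivial_subgroup_iff:
  assumes "A \<in> K1_set G"
  shows "nontrivial_subgroup (\<phi> A) G' \<longleftrightarrow> nontrivial_subgroup A G"
  using phi_mult[OF assms assms] phi_inj[OF G.K1_mult_closed[OF assms assms] assms]
    G.K1_mult_idem_iff[OF assms] G'.K1_mult_idem_iff[OF phi_closed[OF assms]] by metis

lemma phi_nontrivial_subgroup: "nontrivial_subgroup H G \<Longrightarrow> nontrivial_subgroup (\<phi> H) G'"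
  using phi_nontrivial_subgroup_iff G.subgroup_in_K1_set by blast

lemma phi_subgroup: "nontrivial_subgroup H G \<Longrightarrow> subgroup (\<phi> H) G'"
  by (simp add: phi_nontrivial_subgroup G'.nontrivial_subgroup_imp_subgroup)

lemma phi_subset_iff:
  assumes A: "A \<in> K1_set G" and B: "B \<in> K1_set G"
  shows "\<phi> B \<subseteq> \<phi> A \<longleftrightarrow> B \<subseteq> A"
proof -
  \<comment> \<open>Since \<phi> is onto, the idempotent witness for the order in
    \<open>K1 G'\<close> can be taken to be an image \<open>\<phi> E\<close>.\<close>
  have "(\<exists>E'\<in>K1_set G'. K1_mult G' E' E' = E' \<and> \<phi> A = K1_mult G' E' (\<phi> B)) \<longleftrightarrow>
    (\<exists>E\<in>K1_set G. K1_mult G' (\<phi> E) (\<phi> E) = \<phi> E \<and> \<phi> A = K1_mult G' (\<phi> E) (\<phi> B))"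
    by (simp flip: phi_image)
  also have "\<dots> \<longleftrightarrow> (\<exists>E\<in>K1_set G. K1_mult G E E = E \<and> A = K1_mult G E B)"
    using A B by (simp flip: phi_mult add: phi_inj G.K1_mult_closed)
  finally show ?thesis
    using A B phi_closed G.K1_subset_iff G'.K1_subset_iff by simp
qed

text \<open>Let \<phi>(H a) be a coset of \<open>L = \<phi> E\<close>. The idempotents fixing
  \<open>H a\<close> from the left are the subgroups of \<open>H\<close>. As \<open>L\<close> fixes
  its own coset, \<open>E\<close> fixes \<open>H a\<close>, whence
  \<open>L \<subseteq> \<phi> H\<close>; as \<open>H\<close> fixes \<open>H a\<close>, \<phi>(H)
  fixes the coset of \<open>L\<close>, which gives equality.\<close>

lemma phi_r_coset:
  assumes H: "nontrivial_subgroup H G" and a: "a \<in> carrier G"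
  shows "\<exists>a'\<in>carrier G'. \<phi> (H #> a) = \<phi> H #>\<^bsub>G'\<^esub> a'"
proof -
  have Ha: "H #> a \<in> K1_set G" using assms by (rule G.K1_setI)
  obtain L a' where L: "nontrivial_subgroup L G'" "a' \<in> carrier G'" "\<phi> (H #> a) = L #>\<^bsub>G'\<^esub> a'"
    using G'.K1_setE[OF phi_closed[OF Ha]] .
  obtain E where E: "E \<in> K1_set G" "\<phi> E = L"
    using phi_surj G'.subgroup_in_K1_set[OF L(1)] by blast
  have En: "nontrivial_subgroup E G" using E L phi_nontrivial_subgroup_iff by blast
  have H1: "H \<in> K1_set G" using H by (rule G.subgroup_in_K1_set)
  have Ls: "subgroup L G'" using L G'.nontrivial_subgroup_imp_subgroup by blast
  have "\<phi> (K1_mult G E (H #> a)) = \<phi> (H #> a)"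
    using E L Ha phi_mult by (simp add: G'.K1_mult_subgroup_coset G'.generate_subgroup_eq Ls)
  then have EH: "K1_mult G E (H #> a) = H #> a"
    using phi_inj E Ha G.K1_mult_closed by blast
  then have "generate G (E \<union> H) #> a = H #> a"
    using En H a by (simp add: G.K1_mult_subgroup_coset)
  moreover have "subgroup (generate G (E \<union> H)) G"
    using En H by (intro G.generate_is_subgroup) (auto dest: G.nontrivial_subgroup_carrier)
  ultimately have "generate G (E \<union> H) = H"
    using G.r_coset_eq_imp_eq G.nontrivial_subgroup_imp_subgroup[OF H] a by blast
  then have "E \<subseteq> H" using generate.incl[of _ "E \<union> H" G] by blast
  then have LH: "L \<subseteq> \<phi> H" using phi_subset_iff[OF H1 E(1)] E by simp
  have "K1_mult G H (H #> a) = H #> a"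
    using H a by (simp add: G.K1_mult_subgroup_coset G.generate_subgroup_eq
        G.nontrivial_subgroup_imp_subgroup)
  then have "K1_mult G' (\<phi> H) (L #>\<^bsub>G'\<^esub> a') = L #>\<^bsub>G'\<^esub> a'"
    using phi_mult[OF H1 Ha] L by simp
  moreover have "generate G' (\<phi> H \<union> L) = \<phi> H"
    using LH G'.generate_subgroup_eq phi_subgroup[OF H] by (simp add: sup_absorb1)
  ultimately have "\<phi> H #>\<^bsub>G'\<^esub> a' = L #>\<^bsub>G'\<^esub> a'"
    using L phi_nontrivial_subgroup[OF H] by (simp add: G'.K1_mult_subgroup_coset)
  then have "\<phi> (H #> a) = \<phi> H #>\<^bsub>G'\<^esub> a'" using L(3) by simp
  then show ?thesis using L(2) by (rule bexI)
qed

lemma phi_r_coset_mem: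
  assumes H: "nontrivial_subgroup H G" and a: "a \<in> carrier G" and y: "y \<in> \<phi> (H #> a)"
  shows "y \<in> carrier G'" "\<phi> (H #> a) = \<phi> H #>\<^bsub>G'\<^esub> y"
proof -
  obtain a' where a': "a' \<in> carrier G'" "\<phi> (H #> a) = \<phi> H #>\<^bsub>G'\<^esub> a'"
    using phi_r_coset[OF H a] by blast
  show "\<phi> (H #> a) = \<phi> H #>\<^bsub>G'\<^esub> y"
    using G'.repr_independence[OF _ a'(1) phi_subgroup[OF H]] a' y by simp
  show "y \<in> carrier G'"
    using a' y G'.r_coset_subset_G[OF subgroup.subset[OF phi_subgroup[OF H]]] by blast
qed

text \<open>Pulling back a coset of \<phi>(H) gives a coset of some \<open>E\<close> with \<phi>(E)
  = \<phi>(H), and injectivity forces \<open>E = H\<close>.\<close>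

lemma r_coset_in_range_phi:
  assumes H: "nontrivial_subgroup H G" and y: "y \<in> carrier G'"
  shows "\<exists>a\<in>carrier G. \<phi> (H #> a) = \<phi> H #>\<^bsub>G'\<^esub> y"
proof -
  have "\<phi> H #>\<^bsub>G'\<^esub> y \<in> K1_set G'"
    using y phi_nontrivial_subgroup[OF H] by (intro G'.K1_setI)
  then obtain A where A: "A \<in> K1_set G" "\<phi> A = \<phi> H #>\<^bsub>G'\<^esub> y" using phi_surj by blast
  obtain E a where E: "nontrivial_subgroup E G" "a \<in> carrier G" "A = E #> a"
    using A by (auto elim: G.K1_setE)
  obtain a' where a': "a' \<in> carrier G'" "\<phi> A = \<phi> E #>\<^bsub>G'\<^esub> a'" using phi_r_coset E by blast
  then have "\<phi> E = \<phi> H"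
    using G'.r_coset_eq_imp_eq[OF phi_subgroup[OF E(1)] phi_subgroup[OF H] a'(1) y] A by simp
  then have "E = H" using phi_inj[OF G.subgroup_in_K1_set[OF E(1)] G.subgroup_in_K1_set[OF H]] by simp
  then show ?thesis using A E by blast
qed

text \<open>A non-trivial intersection would be the image of a non-trivial subgroup, and reflecting
  inclusions puts that subgroup into \<open>H \<inter> K\<close>.\<close>

lemma phi_Int_trivial:
  assumes H: "nontrivial_subgroup H G" and K: "nontrivial_subgroup K G" and Int: "H \<inter> K = {\<one>}"
  shows "\<phi> H \<inter> \<phi> K = {\<one>\<^bsub>G'\<^esub>}"
proof (rule ccontr)
  assume "\<phi> H \<inter> \<phi> K \<noteq> {\<one>\<^bsub>G'\<^esub>}"
  then have nt: "nontrivial_subgroup (\<phi> H \<inter> \<phi> K) G'"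
    using phi_subgroup H K G'.subgroups_Inter_pair by (simp add: nontrivial_subgroup_def)
  then obtain E where E: "E \<in> K1_set G" "\<phi> E = \<phi> H \<inter> \<phi> K"
    using phi_surj G'.subgroup_in_K1_set by blast
  have "E \<subseteq> H" "E \<subseteq> K"
    using phi_subset_iff[OF G.subgroup_in_K1_set[OF H] E(1)]
      phi_subset_iff[OF G.subgroup_in_K1_set[OF K] E(1)] E(2)
    by simp_all
  moreover have "nontrivial_subgroup E G" 
    using phi_nontrivial_subgroup_iff[OF E(1)] E(2) nt by simp
  ultimately show False using Int G.nontrivial_subgroup_ex[of E] by blast
qed

text \<open>Normality is visible in the semigroup: if \<open>c\<close> normalizes \<open>K\<close>,
  then \<open>K c * K = K c\<close>. Transporting this equation shows that \<phi>(H) normalizes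
  \<phi>(K). The first claim follows because \<open>H K\<close> is the join of \<open>H\<close> and
  \<open>K\<close>, and the join of two subgroups is their semigroup product.\<close>

lemma phi_set_mult:
  assumes H: "nontrivial_subgroup H G" and K: "nontrivial_subgroup K G"
    and norm: "\<And>h k. h \<in> H \<Longrightarrow> k \<in> K \<Longrightarrow> h \<otimes> k \<otimes> inv h \<in> K"
  shows "\<phi> (H <#> K) = \<phi> H <#>\<^bsub>G'\<^esub> \<phi> K" "\<phi> H <#>\<^bsub>G'\<^esub> \<phi> K = \<phi> K <#>\<^bsub>G'\<^esub> \<phi> H"
proof -
  note sub = G.nontrivial_subgroup_imp_subgroup[OF H] G.nontrivial_subgroup_imp_subgroup[OF K]
  have comm: "H <#> K = K <#> H" by (rule G.set_mult_commute_if_normalizes[OF sub norm])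
  have M: "subgroup (H <#> K) G" by (rule G.subgroup_set_mult[OF sub comm])
  have Mn: "nontrivial_subgroup (H <#> K) G"
    by (rule G.nontrivial_subgroup_mono[OF H M G.subset_set_mult(1)[OF sub]])
  \<comment> \<open>All of \<open>H K\<close> normalizes \<open>K\<close>: by \<open>comm\<close>,
    write \<open>m = l h\<close> with \<open>l \<in> K\<close>.\<close>
  have normM: "m \<otimes> k \<otimes> inv m \<in> K" if mM: "m \<in> H <#> K" and k: "k \<in> K" for m k
  proof -
    obtain l h where m: "l \<in> K" "h \<in> H" "m = l \<otimes> h"
      using mM unfolding comm by (auto simp: set_mult_def)
    have c: "l \<in> carrier G" "h \<in> carrier G" "k \<in> carrier G"
      using m k subgroup.mem_carrier[OF sub(1)] subgroup.mem_carrier[OF sub(2)] by auto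
    then have "m \<otimes> k \<otimes> inv m = l \<otimes> (h \<otimes> k \<otimes> inv h) \<otimes> inv l"
      by (simp add: m G.m_assoc G.inv_mult_group)
    then show ?thesis
      using norm m k sub(2) by (simp add: subgroup.m_closed subgroup.m_inv_closed)
  qed
  have K1: "K \<in> K1_set G" using K by (rule G.subgroup_in_K1_set)
  have "y \<otimes>\<^bsub>G'\<^esub> k' \<otimes>\<^bsub>G'\<^esub> inv\<^bsub>G'\<^esub> y \<in> \<phi> K" if y: "y \<in> \<phi> H" and k': "k' \<in> \<phi> K" for y k'
  proof -
    have yc: "y \<in> carrier G'" and kc: "k' \<in> carrier G'"
      using y k' subgroup.mem_carrier[OF phi_subgroup[OF H]] subgroup.mem_carrier[OF phi_subgroup[OF K]]
      by auto
    \<comment> \<open>A preimage \<open>K c\<close> of the coset of \<open>y\<close>. Reflecting its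
      inclusion in \<phi>(H K) only locates \<open>c\<close> in \<open>H K\<close>, not in
      \<open>H\<close>; hence \<open>normM\<close>.\<close>
    obtain c where c: "c \<in> carrier G" "\<phi> (K #> c) = \<phi> K #>\<^bsub>G'\<^esub> y"
      using r_coset_in_range_phi[OF K yc] by blast
    have Kc: "K #> c \<in> K1_set G" using K c by (intro G.K1_setI)
    have "\<phi> H \<subseteq> \<phi> (H <#> K)" "\<phi> K \<subseteq> \<phi> (H <#> K)"
      using phi_subset_iff[OF G.subgroup_in_K1_set[OF Mn]] G.subgroup_in_K1_set H K
        G.subset_set_mult[OF sub] by simp_all
    then have "\<phi> K #>\<^bsub>G'\<^esub> y \<subseteq> \<phi> (H <#> K)"
      using phi_subgroup[OF Mn] y by (auto simp: r_coset_def intro!: subgroup.m_closed)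
    then have "K #> c \<subseteq> H <#> K"
      using c phi_subset_iff[OF G.subgroup_in_K1_set[OF Mn] Kc] by simp
    then have cM: "c \<in> H <#> K" using G.rcos_self[OF c(1) sub(2)] by blast
    have "conj_set G K (inv c) \<subseteq> K" using normM[OF cM] c by (auto simp: G.conj_set_eq)
    then have "K1_mult G (K #> c) K = K #> c"
      using G.K1_mult_coset[OF K K c(1) G.one_closed] c
      by (simp add: G.r_coset_one sub sup_absorb1 G.generate_subgroup_eq)
    then have "K1_mult G' (\<phi> K #>\<^bsub>G'\<^esub> y) (\<phi> K) = \<phi> K #>\<^bsub>G'\<^esub> y"
      using phi_mult[OF Kc K1] c by simp
    then have "y \<otimes>\<^bsub>G'\<^esub> k' \<in> \<phi> K #>\<^bsub>G'\<^esub> y"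
      using G'.mult_mem_K1_mult[OF phi_closed[OF Kc] phi_closed[OF K1], of y k'] c k' yc
        G'.rcos_self phi_subgroup[OF K] by simp
    then show ?thesis using G'.mem_r_coset_iff phi_subgroup[OF K] yc kc by simp
  qed
  then show comm': "\<phi> H <#>\<^bsub>G'\<^esub> \<phi> K = \<phi> K <#>\<^bsub>G'\<^esub> \<phi> H"
    by (rule G'.set_mult_commute_if_normalizes[OF phi_subgroup[OF H] phi_subgroup[OF K]])
  have "\<phi> (K1_mult G H K) = K1_mult G' (\<phi> H) (\<phi> K)"
    using H K by (simp add: phi_mult G.subgroup_in_K1_set)
  then show "\<phi> (H <#> K) = \<phi> H <#>\<^bsub>G'\<^esub> \<phi> K"
    using H K phi_nontrivial_subgroup[OF H] phi_nontrivial_subgroup[OF K] comm comm' sub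
    by (simp add: G.K1_mult_subgroups G'.K1_mult_subgroups G.generate_Un_eq_set_mult
        G'.generate_Un_eq_set_mult phi_subgroup)
qed

text \<open>Both cosets lie in \<phi>((H K) a), a coset of \<phi>(H) \<phi>(K), so
  \<open>r_cosets_meet\<close> applies in \<open>G'\<close>.\<close>

lemma phi_r_cosets_meet:
  assumes H: "nontrivial_subgroup H G" and K: "nontrivial_subgroup K G"
    and comm: "H <#> K = K <#> H"
    and phi: "\<phi> (H <#> K) = \<phi> H <#>\<^bsub>G'\<^esub> \<phi> K" "\<phi> H <#>\<^bsub>G'\<^esub> \<phi> K = \<phi> K <#>\<^bsub>G'\<^esub> \<phi> H"
    and a: "a \<in> carrier G"
  shows "\<exists>c\<in>carrier G'. c \<in> \<phi> (H #> a) \<and> c \<in> \<phi> (K #> a)"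
proof -
  note sub = G.nontrivial_subgroup_imp_subgroup[OF H] G.nontrivial_subgroup_imp_subgroup[OF K]
  have M: "subgroup (H <#> K) G" by (rule G.subgroup_set_mult[OF sub comm])
  have Mn: "nontrivial_subgroup (H <#> K) G"
    by (rule G.nontrivial_subgroup_mono[OF H M G.subset_set_mult(1)[OF sub]])
  obtain x where x: "x \<in> carrier G'" "\<phi> (H #> a) = \<phi> H #>\<^bsub>G'\<^esub> x"
    using phi_r_coset[OF H a] by blast
  obtain y where y: "y \<in> carrier G'" "\<phi> (K #> a) = \<phi> K #>\<^bsub>G'\<^esub> y"
    using phi_r_coset[OF K a] by blast
  obtain z where z: "z \<in> carrier G'" "\<phi> ((H <#> K) #> a) = \<phi> (H <#> K) #>\<^bsub>G'\<^esub> z"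
    using phi_r_coset[OF Mn a] by blast
  have "H #> a \<subseteq> (H <#> K) #> a" "K #> a \<subseteq> (H <#> K) #> a"
    using G.subset_set_mult[OF sub] by (auto simp: r_coset_def)
  then have "\<phi> (H #> a) \<subseteq> \<phi> ((H <#> K) #> a)" "\<phi> (K #> a) \<subseteq> \<phi> ((H <#> K) #> a)"
    using phi_subset_iff H K Mn a by (simp_all add: G.K1_setI)
  then have "x \<in> (\<phi> H <#>\<^bsub>G'\<^esub> \<phi> K) #>\<^bsub>G'\<^esub> z" "y \<in> (\<phi> H <#>\<^bsub>G'\<^esub> \<phi> K) #>\<^bsub>G'\<^esub> z"
    using G'.rcos_self[OF x(1) phi_subgroup[OF H]] G'.rcos_self[OF y(1) phi_subgroup[OF K]]
      x y z phi(1) by auto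
  then show ?thesis
    using G'.r_cosets_meet[OF phi_subgroup[OF H] phi_subgroup[OF K] phi(2) x(1) y(1) z(1)] x y
    by simp
qed

end

section \<open>Minimal subgroups: intersections, conjugates and products\<close>

context group
begin

lemma minimal_subgroup_nontrivial: "minimal_subgroup H G \<Longrightarrow> nontrivial_subgroup H G"
  by (simp add: minimal_subgroup_def)

lemma minimal_subgroup_imp_subgroup: "minimal_subgroup H G \<Longrightarrow> subgroup H G"
  by (simp add: minimal_subgroup_def nontrivial_subgroup_def)

lemma minimal_subgroup_eqI:
  "\<lbrakk>minimal_subgroup H G; subgroup K G; K \<subseteq> H; x \<in> K; x \<noteq> \<one>\<rbrakk> \<Longrightarrow> K = H"
  unfolding minimal_subgroup_def nontrivial_subgroup_def by blast

lemma minimal_subgroup_Int: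
  assumes H: "minimal_subgroup H G" and L: "subgroup L G" and "\<not> H \<subseteq> L"
  shows "H \<inter> L = {\<one>}"
proof -
  have "subgroup (H \<inter> L) G" by (rule subgroups_Inter_pair[OF minimal_subgroup_imp_subgroup[OF H] L])
  moreover have "H \<inter> L \<noteq> H" using assms by blast
  ultimately have "x = \<one>" if "x \<in> H \<inter> L" for x
    using minimal_subgroup_eqI[OF H, of "H \<inter> L" x] that by blast
  then show ?thesis
    using subgroup.one_closed[OF L] subgroup.one_closed[OF minimal_subgroup_imp_subgroup[OF H]] by blast
qed

lemma minimal_subgroups_not_subset:
  "\<lbrakk>minimal_subgroup H G; minimal_subgroup K G; H \<noteq> K\<rbrakk> \<Longrightarrow> \<not> H \<subseteq> K"
  by (auto simp: minimal_subgroup_def)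

lemma minimal_subgroups_Int:
  "\<lbrakk>minimal_subgroup H G; minimal_subgroup K G; H \<noteq> K\<rbrakk> \<Longrightarrow> H \<inter> K = {\<one>}"
  by (simp add: minimal_subgroup_Int minimal_subgroup_imp_subgroup minimal_subgroups_not_subset)

lemma subgroup_conj_set:
  assumes H: "subgroup H G" and g: "g \<in> carrier G"
  shows "subgroup (conj_set G H g) G"
proof (rule subgroupI)
  note HG = subgroup.mem_carrier[OF H]
  show "conj_set G H g \<subseteq> carrier G" by (rule conj_set_subset[OF subgroup.subset[OF H] g])
  show "conj_set G H g \<noteq> {}" using subgroup.one_closed[OF H] by (auto simp: conj_set_eq)
  fix x assume "x \<in> conj_set G H g"
  then obtain h where h: "h \<in> H" "x = inv g \<otimes> h \<otimes> g" by (auto simp: conj_set_eq)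
  then have "inv x = inv g \<otimes> inv h \<otimes> g" using HG g by (simp add: inv_mult_group m_assoc)
  then show "inv x \<in> conj_set G H g"
    using h H by (auto simp: conj_set_eq intro: subgroup.m_inv_closed)
  fix y assume "y \<in> conj_set G H g"
  then obtain k where k: "k \<in> H" "y = inv g \<otimes> k \<otimes> g" by (auto simp: conj_set_eq)
  have "g \<otimes> (inv g \<otimes> (k \<otimes> g)) = k \<otimes> g" using inv_cancel[of "inv g" "k \<otimes> g"] HG k g by simp
  then have "x \<otimes> y = inv g \<otimes> (h \<otimes> k) \<otimes> g" using HG h k g by (simp add: m_assoc)
  then show "x \<otimes> y \<in> conj_set G H g"
    using h k H by (auto simp: conj_set_eq intro!: subgroup.m_closed imageI)
qed

lemma conj_set_conj_set_inv:
  assumes "H \<subseteq> carrier G" "g \<in> carrier G"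
  shows "conj_set G (conj_set G H g) (inv g) = H"
proof -
  have "inv (inv g) \<otimes> (inv g \<otimes> h \<otimes> g) \<otimes> inv g = h" if "h \<in> H" for h
    using assms that inv_cancel[of "inv g" h] by (simp add: m_assoc subset_iff)
  then show ?thesis unfolding conj_set_eq image_image by simp
qed

lemma conj_set_inv_conj_set:
  assumes "H \<subseteq> carrier G" "g \<in> carrier G"
  shows "conj_set G (conj_set G H (inv g)) g = H"
  using conj_set_conj_set_inv[of H "inv g"] assms by simp

lemma conj_set_mono: "H \<subseteq> K \<Longrightarrow> conj_set G H g \<subseteq> conj_set G K g"
  by (auto simp: conj_set_eq)

lemma nontrivial_subgroup_conj_set:
  assumes H: "nontrivial_subgroup H G" and g: "g \<in> carrier G"
  shows "nontrivial_subgroup (conj_set G H g) G"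
proof -
  have "conj_set G {\<one>} (inv g) = {\<one>}" using g by (simp add: conj_set_eq)
  then have "conj_set G H g \<noteq> {\<one>}"
    using conj_set_conj_set_inv[OF nontrivial_subgroup_carrier[OF H] g] H
    by (auto simp: nontrivial_subgroup_def)
  then show ?thesis
    using subgroup_conj_set[OF nontrivial_subgroup_imp_subgroup[OF H] g]
    by (simp add: nontrivial_subgroup_def)
qed

text \<open>A non-trivial subgroup of the conjugate is conjugated back into \<open>H\<close>, where
  minimality applies.\<close>

lemma minimal_subgroup_conj_set:
  assumes H: "minimal_subgroup H G" and g: "g \<in> carrier G"
  shows "minimal_subgroup (conj_set G H g) G"
  unfolding minimal_subgroup_def
proof (intro conjI allI impI)
  have Hn: "nontrivial_subgroup H G" using H by (rule minimal_subgroup_nontrivial)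
  show "nontrivial_subgroup (conj_set G H g) G" by (rule nontrivial_subgroup_conj_set[OF Hn g])
  fix K assume K: "nontrivial_subgroup K G \<and> K \<subseteq> conj_set G H g"
  have "conj_set G K (inv g) \<subseteq> H"
    using conj_set_mono[of K "conj_set G H g" "inv g"] K
      conj_set_conj_set_inv[OF nontrivial_subgroup_carrier[OF Hn] g] by simp
  then have "conj_set G K (inv g) = H"
    using H K nontrivial_subgroup_conj_set[of K "inv g"] g by (simp add: minimal_subgroup_def)
  then show "K = conj_set G H g"
    using conj_set_inv_conj_set[of K g] K nontrivial_subgroup_carrier g by auto
qed

lemma set_mult_unique:
  assumes H: "subgroup H G" and K: "subgroup K G" and Int: "H \<inter> K = {\<one>}"
    and "h \<in> H" "h' \<in> H" "k \<in> K" "k' \<in> K" "h \<otimes> k = h' \<otimes> k'"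
  shows "h = h'" "k = k'"
proof -
  have c: "h \<in> carrier G" "h' \<in> carrier G" "k \<in> carrier G" "k' \<in> carrier G"
    using assms subgroup.mem_carrier by metis+
  have "inv h' \<otimes> h \<otimes> k = k'" using assms(8) c by (simp add: m_assoc inv_cancel)
  then have "inv h' \<otimes> h = k' \<otimes> inv k" using c by (metis inv_closed inv_solve_right m_closed)
  moreover have "inv h' \<otimes> h \<in> H" using assms by (simp add: subgroup.m_closed subgroup.m_inv_closed)
  moreover have "k' \<otimes> inv k \<in> K" using assms by (simp add: subgroup.m_closed subgroup.m_inv_closed)
  ultimately have "inv h' \<otimes> h = \<one>" using Int by auto
  then show "h = h'" using c by (metis inv_closed inv_equality inv_inv)
  then show "k = k'" using assms(8) c by simp
qed

lemma card_set_mult_subgroups: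
  assumes "subgroup H G" "subgroup K G" "H \<inter> K = {\<one>}"
  shows "card (H <#> K) = card H * card K"
proof -
  have "inj_on (\<lambda>(h, k). h \<otimes> k) (H \<times> K)"
    using set_mult_unique[OF assms] by (auto simp: inj_on_def)
  moreover have "H <#> K = (\<lambda>(h, k). h \<otimes> k) ` (H \<times> K)" by (auto simp: set_mult_def)
  ultimately show ?thesis by (simp add: card_image card_cartesian_product)
qed

text \<open>If \<open>h\<close> does not normalize \<open>K\<close>, then \<open>K \<inter> K\<^sup>h = 1\<close>, so that the \<open>H\<close>-components of the elements
  \<open>h k\<close> of \<open>H K = K H\<close> are pairwise distinct for \<open>k \<in> K\<close>; none of them is trivial, since otherwise
  \<open>h \<in> K\<close>.\<close>

lemma minimal_subgroup_normalized:
  assumes H: "subgroup H G" and fin: "finite H" and K: "minimal_subgroup K G"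
    and comm: "H <#> K = K <#> H" and Int: "H \<inter> K = {\<one>}" and le: "card H \<le> card K"
    and h: "h \<in> H" and k: "k \<in> K"
  shows "h \<otimes> k \<otimes> inv h \<in> K"
proof (rule ccontr)
  assume nK: "h \<otimes> k \<otimes> inv h \<notin> K"
  have Ks: "subgroup K G" using K by (rule minimal_subgroup_imp_subgroup)
  note HG = subgroup.mem_carrier[OF H] and KG = subgroup.mem_carrier[OF Ks]
  have hc: "h \<in> carrier G" using h HG by simp
  \<comment> \<open>Both sides are minimal, so inclusion would mean equality, and \<open>h\<close>
    would normalize \<open>K\<close>, against \<open>nK\<close>.\<close>
  have "\<not> K \<subseteq> conj_set G K h"
  proof
    assume "K \<subseteq> conj_set G K h"
    then have "K = conj_set G K h"
      using minimal_subgroup_conj_set[OF K hc] K by (simp add: minimal_subgroup_def)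
    then have "k \<in> conj_set G K h" using k by simp
    have "conj_set G K (inv h) = K"
      using \<open>K = conj_set G K h\<close> conj_set_conj_set_inv[OF subgroup.subset[OF Ks] hc] by simp
    moreover have "h \<otimes> k \<otimes> inv h \<in> conj_set G K (inv h)" using k hc by (auto simp: conj_set_eq)
    ultimately show False using nK by simp
  qed
  then have KK: "K \<inter> conj_set G K h = {\<one>}"
    using minimal_subgroup_Int[OF K subgroup_conj_set[OF Ks hc]] by simp
  have "\<exists>h'\<in>H. \<exists>k'\<in>K. h \<otimes> l = k' \<otimes> h'" if "l \<in> K" for l
    using comm h that unfolding set_mult_def by blast
  \<comment> \<open>\<open>f l\<close> and \<open>g l\<close> are the components in \<open>H\<close>
    and \<open>K\<close> of \<open>h l\<close>, written as an element of \<open>K H\<close>.\<close>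
  then obtain f g where fg: "\<And>l. l \<in> K \<Longrightarrow> f l \<in> H \<and> g l \<in> K \<and> h \<otimes> l = g l \<otimes> f l" by metis
  have "inj_on f K"
  proof (rule inj_onI)
    fix l m assume l: "l \<in> K" and m: "m \<in> K" and eq: "f l = f m"
    obtain u where u: "u \<in> K" "h \<otimes> l = u \<otimes> f l" using fg[OF l] by blast
    obtain v where v: "v \<in> K" "h \<otimes> m = v \<otimes> f l" using fg[OF m] eq by auto
    have fl: "f l \<in> carrier G" using fg[OF l] HG by blast
    have c: "l \<in> carrier G" "m \<in> carrier G" "u \<in> carrier G" "v \<in> carrier G"
      using l m u v KG by auto
    have "inv v \<otimes> (h \<otimes> m) = f l" unfolding v(2) using inv_cancel[OF c(4) fl] .
    then have "h \<otimes> l = u \<otimes> (inv v \<otimes> (h \<otimes> m))" using u(2) by simp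
    then have "inv h \<otimes> (h \<otimes> l) = inv h \<otimes> (u \<otimes> inv v) \<otimes> h \<otimes> m"
      using c hc by (simp add: m_assoc)
    then have "l = (inv h \<otimes> (u \<otimes> inv v) \<otimes> h) \<otimes> m"
      using inv_cancel[OF hc c(1)] by simp
    \<comment> \<open>Equal \<open>H\<close>-components make the quotient \<open>l m^-1\<close> an
      element of the conjugate of \<open>K\<close>; it also lies in \<open>K\<close>.\<close>
    then have "l \<otimes> inv m = inv h \<otimes> (u \<otimes> inv v) \<otimes> h"
      using c hc by (simp add: m_assoc)
    moreover have "u \<otimes> inv v \<in> K"
      using u v Ks by (simp add: subgroup.m_closed subgroup.m_inv_closed)
    ultimately have "l \<otimes> inv m \<in> conj_set G K h" by (auto simp: conj_set_eq)
    moreover have "l \<otimes> inv m \<in> K" using l m Ks by (simp add: subgroup.m_closed subgroup.m_inv_closed)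
    ultimately have "l \<otimes> inv m = \<one>" using KK by blast
    then show "l = m" using c by (metis inv_closed inv_equality inv_inv)
  qed
  moreover have "f ` K \<subseteq> H - {\<one>}"
  proof
    fix x assume "x \<in> f ` K"
    then obtain l where l: "l \<in> K" "x = f l" by blast
    have "f l \<noteq> \<one>"
    proof
      assume "f l = \<one>"
      then have "h \<otimes> l \<in> K" using fg[OF l(1)] KG by simp
      then have "h \<otimes> l \<otimes> inv l \<in> K" using l Ks by (simp add: subgroup.m_closed subgroup.m_inv_closed)
      then have "h \<in> K" using l KG hc by (simp add: m_assoc)
      then show False using nK k Ks by (simp add: subgroup.m_closed subgroup.m_inv_closed)
    qed
    then show "x \<in> H - {\<one>}" using fg l by simp
  qed
  \<comment> \<open>\<open>H\<close> without \<open>\<one>\<close> would have at least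
    \<open>card K\<close> elements, contradicting \<open>le\<close>.\<close>
  ultimately have "card K \<le> card (H - {\<one>})" using fin by (intro card_inj_on_le) auto
  moreover have "card (H - {\<one>}) < card H"
    using fin subgroup.one_closed[OF H] by (intro psubset_card_mono) auto
  ultimately show False using le by simp
qed

text \<open>By the modular law \<open>H L = H (H L \<inter> K)\<close>, and \<open>H L \<inter> K\<close> cannot be trivial.\<close>

lemma set_mult_minimal_eq:
  assumes H: "minimal_subgroup H G" and K: "minimal_subgroup K G" and L: "minimal_subgroup L G"
    and HL: "H <#> L = L <#> H" and ne: "L \<noteq> H" and sub: "L \<subseteq> H <#> K"
  shows "H <#> L = H <#> K"
proof -
  note s = minimal_subgroup_imp_subgroup[OF H] minimal_subgroup_imp_subgroup[OF K]
    minimal_subgroup_imp_subgroup[OF L]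
  note c = subgroup.mem_carrier[OF s(1)] subgroup.mem_carrier[OF s(2)]
  have M: "subgroup (H <#> L) G" by (rule subgroup_set_mult[OF s(1,3) HL])
  have "K \<subseteq> H <#> L"
  proof (rule ccontr)
    assume "\<not> K \<subseteq> H <#> L"
    then have triv: "K \<inter> (H <#> L) = {\<one>}" by (rule minimal_subgroup_Int[OF K M])
    \<comment> \<open>If the intersection were trivial, the \<open>K\<close>-component of each
      \<open>l\<close> would vanish, giving \<open>L \<subseteq> H\<close>.\<close>
    have "l \<in> H" if l: "l \<in> L" for l
    proof -
      obtain h k where hk: "h \<in> H" "k \<in> K" "l = h \<otimes> k" using sub l by (auto simp: set_mult_def)
      have "k = inv h \<otimes> l" using hk c by (simp add: inv_cancel)
      moreover have "inv h \<otimes> l \<in> H <#> L"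
        using hk(1) l subset_set_mult[OF s(1,3)] by (intro subgroup.m_closed[OF M] subgroup.m_inv_closed[OF M]) auto
      ultimately have "k = \<one>" using triv hk by blast
      then show ?thesis using hk c by simp
    qed
    then show False using minimal_subgroups_not_subset[OF L H ne] by blast
  qed
  then have "H <#> K \<subseteq> H <#> L"
    using subset_set_mult[OF s(1,3)] by (intro set_mult_subset_subgroup[OF M]) auto
  moreover have "H <#> L \<subseteq> H <#> K"
  proof
    fix x assume "x \<in> H <#> L"
    then obtain h l where hl: "h \<in> H" "l \<in> L" "x = h \<otimes> l" by (auto simp: set_mult_def)
    moreover obtain h' k where hk: "h' \<in> H" "k \<in> K" "l = h' \<otimes> k"
      using sub hl by (auto simp: set_mult_def)
    ultimately have "x = (h \<otimes> h') \<otimes> k" using c by (simp add: m_assoc)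
    then show "x \<in> H <#> K" using hl hk s(1) by (auto simp: set_mult_def intro: subgroup.m_closed)
  qed
  ultimately show ?thesis by blast
qed

section \<open>Element orders, minimal subgroups and \<open>Omega\<close>\<close>

text \<open>The order of a non-trivial element of this cyclic group divides the prime
  \<open>ord x\<close>, hence equals it, so the element generates a subgroup of full size.\<close>

lemma minimal_subgroup_generate:
  assumes x: "x \<in> carrier G" and p: "Factorial_Ring.prime (ord x)"
  shows "minimal_subgroup (generate G {x}) G"
  unfolding minimal_subgroup_def nontrivial_subgroup_def
proof (intro conjI allI impI)
  have ord0: "ord x \<noteq> 0" using p by auto
  show s: "subgroup (generate G {x}) G" using x by (intro generate_is_subgroup) auto
  have fin: "finite (generate G {x})"
    using generate_pow_card[OF x] ord0 card.infinite by force
  show "generate G {x} \<noteq> {\<one>}"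
    using generate_pow_card[OF x] p by auto
  fix K assume K: "(subgroup K G \<and> K \<noteq> {\<one>}) \<and> K \<subseteq> generate G {x}"
  then obtain y where y: "y \<in> K" "y \<noteq> \<one>"
    using nontrivial_subgroup_ex[of K] by (auto simp: nontrivial_subgroup_def)
  then obtain k where k: "y = x [^] (k::nat)" using K generate_pow_nat[OF x ord0] by blast
  have yc: "y \<in> carrier G" using k x by simp
  have "y [^] ord x = (x [^] ord x) [^] k" using k x by (simp add: nat_pow_pow mult.commute del: pow_ord_eq_1)
  then have "y [^] ord x = \<one>" using x by simp
  then have "ord y dvd ord x" using pow_eq_id[OF yc] by simp
  moreover have "ord y \<noteq> 1" using y yc ord_eq_1 by simp
  ultimately have "ord y = ord x" using p by (auto simp: prime_nat_iff)
  then have "card (generate G {y}) = card (generate G {x})"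
    using generate_pow_card x yc by simp
  moreover have sub: "generate G {y} \<subseteq> K" using K y by (intro generate_subgroup_incl) auto
  ultimately have "generate G {y} = generate G {x}" using K fin by (intro card_subset_eq) auto
  then show "K = generate G {x}" using sub K by blast
qed

lemma ord_pow_prime_factor:
  assumes "x \<in> carrier G" "ord x \<noteq> 0" "Factorial_Ring.prime r" "r dvd ord x"
  shows "ord (x [^] (ord x div r)) = r"
proof -
  obtain m where m: "ord x = r * m" using assms by (auto elim: dvdE)
  have r: "r \<noteq> 0" using assms(3) by auto
  then have "ord x div r = m" "m \<noteq> 0" "m dvd ord x" using m assms(2) by auto
  then show ?thesis using ord_pow[of x m] assms(1) m by simp
qed

lemma periodic_ord_nonzero:
  "periodic_group G \<Longrightarrow> x \<in> carrier G \<Longrightarrow> ord x \<noteq> 0"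
  unfolding periodic_group_def using pow_eq_id by fastforce

text \<open>A non-trivial element has a power \<open>y\<close> of prime order, its own order being
  non-zero by periodicity; minimality makes \<open>y\<close> generate \<open>H\<close>.\<close>

lemma minimal_subgroup_prime_card:
  assumes per: "periodic_group G" and H: "minimal_subgroup H G"
  shows "Factorial_Ring.prime (card H)"
proof -
  obtain x where x: "x \<in> H" "x \<noteq> \<one>"
    using nontrivial_subgroup_ex minimal_subgroup_nontrivial[OF H] by blast
  have s: "subgroup H G" using H by (rule minimal_subgroup_imp_subgroup)
  have xc: "x \<in> carrier G" using subgroup.mem_carrier[OF s x(1)] .
  have "ord x \<noteq> 1" using ord_eq_1[OF xc] x(2) by simp
  from prime_factor_nat[OF this] obtain r where r: "Factorial_Ring.prime r" "r dvd ord x"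
    by blast
  define y where "y = x [^] (ord x div r)"
  have yc: "y \<in> carrier G" using xc by (simp add: y_def)
  have oy: "ord y = r"
    unfolding y_def by (rule ord_pow_prime_factor[OF xc periodic_ord_nonzero[OF per xc] r])
  have "x [^] n \<in> H" for n :: nat
    using x s by (induction n) (auto intro: subgroup.one_closed subgroup.m_closed)
  then have "generate G {y} \<subseteq> H" using s by (intro generate_subgroup_incl) (auto simp: y_def)
  moreover have "nontrivial_subgroup (generate G {y}) G"
    using minimal_subgroup_generate[OF yc] oy r by (simp add: minimal_subgroup_nontrivial)
  ultimately have "generate G {y} = H" using H by (simp add: minimal_subgroup_def)
  then show ?thesis using generate_pow_card[OF yc] oy r by simp
qed

lemma minimal_subgroup_finite:
  "periodic_group G \<Longrightarrow> minimal_subgroup H G \<Longrightarrow> finite H"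
  using prime_gt_0_nat[OF minimal_subgroup_prime_card] by (rule card_ge_0_finite)

text \<open>A prime factor \<open>r \<noteq> p\<close> of the order of an element would produce a
  minimal subgroup of order \<open>r\<close>.\<close>

lemma p_group_if_minimal_subgroups_card:
  assumes per: "periodic_group G" and p: "Factorial_Ring.prime p"
    and min: "\<And>L. minimal_subgroup L G \<Longrightarrow> card L = p"
  shows "p_group p G"
  unfolding p_group_def
proof (intro conjI ballI)
  fix x assume x: "x \<in> carrier G"
  have ord0: "ord x \<noteq> 0" by (rule periodic_ord_nonzero[OF per x])
  obtain m where m: "ord x = p ^ multiplicity p (ord x) * m" "\<not> p dvd m"
    using multiplicity_decompose'[of "ord x" p] ord0 p by (metis not_prime_unit)
  have "m = 1"
  proof (rule ccontr)
    assume "m \<noteq> 1"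
    from prime_factor_nat[OF this] obtain r where r: "Factorial_Ring.prime r" "r dvd m"
      by blast
    then have "r dvd ord x" using m(1) by (metis dvd_mult)
    then have o: "ord (x [^] (ord x div r)) = r" by (rule ord_pow_prime_factor[OF x ord0 r(1)])
    have c: "x [^] (ord x div r) \<in> carrier G" using x by simp
    have "minimal_subgroup (generate G {x [^] (ord x div r)}) G"
      using minimal_subgroup_generate[OF c] o r by simp
    then have "p = r" using min generate_pow_card[OF c] o by simp
    then show False using r m by simp
  qed
  then show "\<exists>k. ord x = p ^ k" using m(1) by (metis mult.right_neutral)
qed (use p in auto)

text \<open>Each generator of \<open>Omega_p p G\<close> is trivial or has order \<open>p\<close>;
  in the latter case it lies in the minimal subgroup that it generates.\<close>

lemma Omega_subset:
  assumes M: "subgroup M G" and min: "\<And>L. minimal_subgroup L G \<Longrightarrow> L \<subseteq> M"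
  shows "Omega G \<subseteq> M"
proof -
  have "Omega_p p G \<subseteq> M" if p: "Factorial_Ring.prime p" for p
    unfolding Omega_p_def
  proof (rule generate_subgroup_incl[OF _ M], rule subsetI)
    fix x assume "x \<in> {x \<in> carrier G. x [^] p = \<one>}"
    then have x: "x \<in> carrier G" "ord x dvd p" using pow_eq_id by auto
    show "x \<in> M"
    proof (cases "x = \<one>")
      case True
      then show ?thesis using subgroup.one_closed[OF M] by simp
    next
      case False
      then have "ord x = p" using x p ord_eq_1 by (auto simp: prime_nat_iff)
      then have "generate G {x} \<subseteq> M" using minimal_subgroup_generate x p min by simp
      then show ?thesis using generate.incl[of x "{x}" G] by blast
    qed
  qed
  then show ?thesis unfolding Omega_def by (intro generate_subgroup_incl[OF _ M]) auto
qed

end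

section \<open>Existence of a minimal subgroup outside \<open>H K\<close>\<close>

context group
begin

text \<open>If a third minimal subgroup lies in \<open>H K\<close>, then \<open>|H| = |K|\<close>; were all of them in \<open>H K\<close>, then \<open>G\<close>
  would be a \<open>p\<close>-group with \<open>\<Omega>(G) \<subseteq> H K\<close> of order at most \<open>p\<^sup>2\<close>.\<close>

lemma ex_minimal_subgroup_not_subset:
  assumes per: "periodic_group G"
    and comm: "\<And>H K. minimal_subgroup H G \<Longrightarrow> minimal_subgroup K G \<Longrightarrow> H <#> K = K <#> H"
    and cond: "(\<nexists>p. p_group p G) \<or>
         (\<exists>p. p_group p G \<and> (infinite (Omega G) \<or> card (Omega G) > p ^ 2))"
    and H: "minimal_subgroup H G" and K: "minimal_subgroup K G" and HK: "H \<noteq> K"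
    and L: "minimal_subgroup L G" "L \<noteq> H" "L \<noteq> K" "L \<subseteq> H <#> K"
  shows "\<exists>M. minimal_subgroup M G \<and> \<not> M \<subseteq> H <#> K"
proof (rule ccontr)
  assume "\<not> ?thesis"
  then have all: "M \<subseteq> H <#> K" if "minimal_subgroup M G" for M using that by blast
  note sub = minimal_subgroup_imp_subgroup
  have cardHK: "card (H <#> K) = card H * card K"
    by (rule card_set_mult_subgroups[OF sub[OF H] sub[OF K] minimal_subgroups_Int[OF H K HK]])
  have pos: "card H > 0" "card K > 0"
    using prime_gt_0_nat[OF minimal_subgroup_prime_card[OF per]] H K by simp_all
  \<comment> \<open>For a third \<open>M\<close>, both \<open>H M\<close> and \<open>K M\<close>
    equal \<open>H K\<close>; comparing cardinalities gives \<open>card M = card K\<close> and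
    \<open>card M = card H\<close>.\<close>
  have third: "card M = card H \<and> card M = card K"
    if M: "minimal_subgroup M G" "M \<noteq> H" "M \<noteq> K" for M
  proof -
    have "H <#> M = H <#> K"
      by (rule set_mult_minimal_eq[OF H K M(1) comm[OF H M(1)] M(2) all[OF M(1)]])
    moreover have "card (H <#> M) = card H * card M"
      by (rule card_set_mult_subgroups[OF sub[OF H] sub[OF M(1)]
            minimal_subgroups_Int[OF H M(1) M(2)[symmetric]]])
    ultimately have 1: "card H * card M = card H * card K" using cardHK by argo
    have "M \<subseteq> K <#> H" using all[OF M(1)] unfolding comm[OF H K] .
    then have "K <#> M = K <#> H"
      by (rule set_mult_minimal_eq[OF K H M(1) comm[OF K M(1)] M(3)])
    moreover have "card (K <#> M) = card K * card M"
      by (rule card_set_mult_subgroups[OF sub[OF K] sub[OF M(1)]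
            minimal_subgroups_Int[OF K M(1) M(3)[symmetric]]])
    ultimately have "card K * card M = card H * card K" using cardHK unfolding comm[OF H K] by argo
    then show ?thesis using 1 pos by simp
  qed
  define p where "p = card H"
  have cardK: "card K = p" using third[OF L(1-3)] by (simp add: p_def)
  have p: "Factorial_Ring.prime p" unfolding p_def by (rule minimal_subgroup_prime_card[OF per H])
  have "card M = p" if "minimal_subgroup M G" for M
    using third[OF that] cardK by (cases "M = H \<or> M = K") (auto simp: p_def)
  then have pG: "p_group p G" by (rule p_group_if_minimal_subgroups_card[OF per p])
  have Om: "Omega G \<subseteq> H <#> K"
    by (rule Omega_subset[OF subgroup_set_mult[OF sub[OF H] sub[OF K] comm[OF H K]] all])
  have cardp: "card (H <#> K) = p ^ 2" using cardHK cardK by (simp add: p_def power2_eq_square)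
  moreover have "p > 0" using p by (rule prime_gt_0_nat)
  \<comment> \<open>Infinite sets have \<open>card\<close> 0, so a positive value gives
    finiteness.\<close>
  ultimately have fin: "finite (H <#> K)" by (intro card_ge_0_finite) simp
  then have "finite (Omega G)" using Om by (rule finite_subset[rotated])
  \<comment> \<open>The prime \<open>q\<close> supplied by \<open>cond\<close> is not yet known to
    be \<open>p\<close>. The two bounds on \<open>card (Omega G)\<close> force
    \<open>q \<noteq> p\<close>, whereas the order of a non-trivial element of \<open>H\<close> is a
    power of both.\<close>
  then obtain q where q: "p_group q G" "card (Omega G) > q ^ 2" using cond pG by blast
  moreover have "card (Omega G) \<le> p ^ 2" using card_mono[OF fin Om] cardp by simp
  ultimately have "q \<noteq> p" by auto
  obtain x where x: "x \<in> H" "x \<noteq> \<one>"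
    using nontrivial_subgroup_ex[OF minimal_subgroup_nontrivial[OF H]] by blast
  have xc: "x \<in> carrier G" by (rule subgroup.mem_carrier[OF sub[OF H] x(1)])
  obtain k l where kl: "ord x = p ^ k" "ord x = q ^ l"
    using pG q(1) xc unfolding p_group_def by blast
  have "ord x \<noteq> 1" using ord_eq_1[OF xc] x(2) by simp
  then have "k > 0" using kl(1) by (cases k) auto
  then have "p dvd q ^ l" using kl by (metis dvd_power)
  then have "p dvd q" using p prime_dvd_power by blast
  then show False using primes_dvd_imp_eq[OF p, of q] q(1) \<open>q \<noteq> p\<close> by (simp add: p_group_def)
qed

end

section \<open>The group isomorphism obtained from \<phi>\<close>

locale K1_iso_permuting = K1_iso +
  assumes periodic: "periodic_group G"
    and commute: "\<And>H K. minimal_subgroup H G \<Longrightarrow> minimal_subgroup K G \<Longrightarrow> H <#> K = K <#> H"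
begin

lemmas nontriv = G.minimal_subgroup_nontrivial

text \<open>The claim is symmetric in \<open>H\<close> and \<open>K\<close>, so
  \<open>card H \<le> card K\<close> may be assumed; then \<open>H\<close> normalizes
  \<open>K\<close> by \<open>minimal_subgroup_normalized\<close>, and \<open>phi_set_mult\<close>
  applies.\<close>

lemma phi_set_mult_minimal:
  assumes H: "minimal_subgroup H G" and K: "minimal_subgroup K G" and ne: "H \<noteq> K"
  shows "\<phi> (H <#> K) = \<phi> H <#>\<^bsub>G'\<^esub> \<phi> K \<and> \<phi> H <#>\<^bsub>G'\<^esub> \<phi> K = \<phi> K <#>\<^bsub>G'\<^esub> \<phi> H"
  using H K ne
proof (induction "card H" "card K" arbitrary: H K rule: linorder_wlog)
  case le
  note norm = G.minimal_subgroup_normalized[OF G.minimal_subgroup_imp_subgroup[OF le(2)]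
      G.minimal_subgroup_finite[OF periodic le(2)] le(3) commute[OF le(2,3)]
      G.minimal_subgroups_Int[OF le(2,3,4)] le(1)]
  show ?case using phi_set_mult[OF nontriv[OF le(2)] nontriv[OF le(3)] norm] by simp
next
  case sym
  then show ?case using commute[of H K] by metis
qed

lemma phi_minimal_meet:
  assumes H: "minimal_subgroup H G" and K: "minimal_subgroup K G" and ne: "H \<noteq> K"
    and a: "a \<in> carrier G"
  shows "\<exists>c\<in>carrier G'. c \<in> \<phi> (H #> a) \<and> c \<in> \<phi> (K #> a)"
  using phi_set_mult_minimal[OF H K ne]
  by (intro phi_r_cosets_meet[OF nontriv[OF H] nontriv[OF K] commute[OF H K] _ _ a]) simp_all

text \<open>\<open>H\<close> and \<open>K\<close> intersect trivially, hence so do their images,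
  whose cosets therefore share at most one point.\<close>

lemma phi_minimal_unique:
  assumes H: "minimal_subgroup H G" and K: "minimal_subgroup K G" and ne: "H \<noteq> K"
    and a: "a \<in> carrier G"
    and c: "c \<in> \<phi> (H #> a)" "c \<in> \<phi> (K #> a)" and d: "d \<in> \<phi> (H #> a)" "d \<in> \<phi> (K #> a)"
  shows "c = d"
proof (rule G'.r_cosets_Int)
  show "\<phi> H \<inter> \<phi> K = {\<one>\<^bsub>G'\<^esub>}"
    by (rule phi_Int_trivial[OF nontriv[OF H] nontriv[OF K] G.minimal_subgroups_Int[OF H K ne]])
  show "c \<in> (\<phi> H #>\<^bsub>G'\<^esub> c) \<inter> (\<phi> K #>\<^bsub>G'\<^esub> c)" "d \<in> (\<phi> H #>\<^bsub>G'\<^esub> c) \<inter> (\<phi> K #>\<^bsub>G'\<^esub> c)"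
    using phi_r_coset_mem[OF nontriv[OF H] a c(1)] phi_r_coset_mem[OF nontriv[OF K] a c(2)] c d by simp_all
qed (use phi_subgroup[OF nontriv] H K phi_r_coset_mem(1)[OF nontriv[OF H] a c(1)] in simp_all)

text \<open>Let \<phi>(L a) meet \<phi>(H a) in \<open>x\<close> and \<phi>(K a) in
  \<open>y\<close>. Then \<open>y x^-1\<close> lies in \<phi>(L) and, passing through
  \<open>c\<close>, also in \<phi>(H K). These intersect trivially, so \<open>x = y\<close> is
  common to \<phi>(H a) and \<phi>(K a), and equals \<open>c\<close> by uniqueness.\<close>

lemma phi_third_coset:
  assumes H: "minimal_subgroup H G" and K: "minimal_subgroup K G" and ne: "H \<noteq> K"
    and L: "minimal_subgroup L G" and nL: "\<not> L \<subseteq> H <#> K"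
    and a: "a \<in> carrier G" and c: "c \<in> \<phi> (H #> a)" "c \<in> \<phi> (K #> a)"
  shows "c \<in> \<phi> (L #> a)"
proof -
  note sub = G.minimal_subgroup_imp_subgroup
  have M: "subgroup (H <#> K) G" by (rule G.subgroup_set_mult[OF sub[OF H] sub[OF K] commute[OF H K]])
  have incl: "H \<subseteq> H <#> K" "K \<subseteq> H <#> K" by (rule G.subset_set_mult[OF sub[OF H] sub[OF K]])+
  have Mn: "nontrivial_subgroup (H <#> K) G"
    by (rule G.nontrivial_subgroup_mono[OF nontriv[OF H] M incl(1)])
  have "L \<noteq> H" "L \<noteq> K" using incl nL by auto
  then obtain x y where x: "x \<in> carrier G'" "x \<in> \<phi> (H #> a)" "x \<in> \<phi> (L #> a)"
    and y: "y \<in> carrier G'" "y \<in> \<phi> (K #> a)" "y \<in> \<phi> (L #> a)"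
    using phi_minimal_meet[OF H L _ a] phi_minimal_meet[OF K L _ a] by auto
  have cc: "c \<in> carrier G'" by (rule phi_r_coset_mem(1)[OF nontriv[OF H] a c(1)])
  have xc: "x \<otimes>\<^bsub>G'\<^esub> inv\<^bsub>G'\<^esub> c \<in> \<phi> H"
    using phi_r_coset_mem(2)[OF nontriv[OF H] a c(1)] x
      G'.mem_r_coset_iff[OF phi_subgroup[OF nontriv[OF H]] cc x(1)] by simp
  have yc: "y \<otimes>\<^bsub>G'\<^esub> inv\<^bsub>G'\<^esub> c \<in> \<phi> K"
    using phi_r_coset_mem(2)[OF nontriv[OF K] a c(2)] y
      G'.mem_r_coset_iff[OF phi_subgroup[OF nontriv[OF K]] cc y(1)] by simp
  have yx: "y \<otimes>\<^bsub>G'\<^esub> inv\<^bsub>G'\<^esub> x \<in> \<phi> L"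
    using phi_r_coset_mem(2)[OF nontriv[OF L] a x(3)] y
      G'.mem_r_coset_iff[OF phi_subgroup[OF nontriv[OF L]] x(1) y(1)] by simp
  have "\<phi> H \<subseteq> \<phi> (H <#> K)" "\<phi> K \<subseteq> \<phi> (H <#> K)"
    using phi_subset_iff[OF G.subgroup_in_K1_set[OF Mn]] G.subgroup_in_K1_set[OF nontriv] H K incl
    by simp_all
  then have "x \<otimes>\<^bsub>G'\<^esub> inv\<^bsub>G'\<^esub> c \<in> \<phi> (H <#> K)" "y \<otimes>\<^bsub>G'\<^esub> inv\<^bsub>G'\<^esub> c \<in> \<phi> (H <#> K)"
    using xc yc by blast+
  then have "(y \<otimes>\<^bsub>G'\<^esub> inv\<^bsub>G'\<^esub> c) \<otimes>\<^bsub>G'\<^esub> inv\<^bsub>G'\<^esub> (x \<otimes>\<^bsub>G'\<^esub> inv\<^bsub>G'\<^esub> c) \<in> \<phi> (H <#> K)"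
    using subgroup.m_closed[OF phi_subgroup[OF Mn]] subgroup.m_inv_closed[OF phi_subgroup[OF Mn]]
    by simp
  moreover have "(y \<otimes>\<^bsub>G'\<^esub> inv\<^bsub>G'\<^esub> c) \<otimes>\<^bsub>G'\<^esub> inv\<^bsub>G'\<^esub> (x \<otimes>\<^bsub>G'\<^esub> inv\<^bsub>G'\<^esub> c) = y \<otimes>\<^bsub>G'\<^esub> inv\<^bsub>G'\<^esub> x"
    using x(1) y(1) cc by (simp add: G'.inv_mult_group G'.m_assoc G'.inv_cancel)
  moreover have "\<phi> L \<inter> \<phi> (H <#> K) = {\<one>\<^bsub>G'\<^esub>}"
    by (rule phi_Int_trivial[OF nontriv[OF L] Mn G.minimal_subgroup_Int[OF L M nL]])
  ultimately have "y \<otimes>\<^bsub>G'\<^esub> inv\<^bsub>G'\<^esub> x = \<one>\<^bsub>G'\<^esub>" using yx by auto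
  then have "y = x" using x(1) y(1) by (metis G'.inv_equality G'.inv_closed G'.inv_inv)
  then have "c = x" using phi_minimal_unique[OF H K ne a c x(2)] y by simp
  then show ?thesis using x by simp
qed

text \<open>A third minimal subgroup \<open>L \<subseteq> H K\<close> is handled through some \<open>M\<close> outside \<open>H K = H L\<close>: then \<open>L\<close> is not
  contained in \<open>H M\<close>.\<close>

lemma phi_common_point:
  assumes H: "minimal_subgroup H G" and K: "minimal_subgroup K G" and ne: "H \<noteq> K"
    and outside: "\<And>L. \<lbrakk>minimal_subgroup L G; L \<noteq> H; L \<noteq> K; L \<subseteq> H <#> K\<rbrakk>
      \<Longrightarrow> \<exists>M. minimal_subgroup M G \<and> \<not> M \<subseteq> H <#> K"
    and a: "a \<in> carrier G" and c: "c \<in> \<phi> (H #> a)" "c \<in> \<phi> (K #> a)"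
    and L: "minimal_subgroup L G"
  shows "c \<in> \<phi> (L #> a)"
proof (cases "L \<noteq> H \<and> L \<noteq> K \<and> L \<subseteq> H <#> K")
  case False
  then show ?thesis using c phi_third_coset[OF H K ne L _ a c] by blast
next
  case True
  note sub = G.minimal_subgroup_imp_subgroup
  obtain M where M: "minimal_subgroup M G" "\<not> M \<subseteq> H <#> K" using outside[OF L] True by blast
  have HM: "H \<noteq> M" using M G.subset_set_mult(1)[OF sub[OF H] sub[OF K]] by blast
  \<comment> \<open>Otherwise \<open>H M = H L = H K\<close> would contain \<open>M\<close>.\<close>
  have "\<not> L \<subseteq> H <#> M"
  proof
    assume "L \<subseteq> H <#> M"
    then have "H <#> L = H <#> M"
      using G.set_mult_minimal_eq[OF H M(1) L commute[OF H L]] True by simp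
    moreover have "H <#> L = H <#> K"
      using G.set_mult_minimal_eq[OF H K L commute[OF H L]] True by simp
    ultimately show False using M(2) G.subset_set_mult(2)[OF sub[OF H] sub[OF M(1)]] by simp
  qed
  \<comment> \<open>\<open>phi_third_coset\<close> is applied twice: the pair \<open>H\<close>,
    \<open>K\<close> puts \<open>c\<close> into \<phi>(M a), then the pair \<open>H\<close>,
    \<open>M\<close> puts it into \<phi>(L a).\<close>
  then show ?thesis
    by (rule phi_third_coset[OF H M(1) HM L _ a c(1) phi_third_coset[OF H K ne M a c]])
qed

text \<open>The common point \<theta>(a) is already determined by \<open>H\<close> and
  \<open>K\<close>. For injectivity, it determines the cosets \<open>H a\<close> and
  \<open>K a\<close>, which meet only in \<open>a\<close>. For surjectivity, the preimages of the
  cosets of \<phi>(H) and \<phi>(K) through \<open>y\<close> meet in some \<open>c\<close>, and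
  \<theta>(c) = y.\<close>

lemma iso_if_common_points:
  assumes H: "minimal_subgroup H G" and K: "minimal_subgroup K G" and ne: "H \<noteq> K"
    and ex: "\<And>a. a \<in> carrier G \<Longrightarrow> \<exists>c. \<forall>L. minimal_subgroup L G \<longrightarrow> c \<in> \<phi> (L #> a)"
  shows "G \<cong> G'"
proof -
  note sub = G.minimal_subgroup_imp_subgroup
  obtain \<theta> where \<theta>: "\<And>a L. \<lbrakk>a \<in> carrier G; minimal_subgroup L G\<rbrakk> \<Longrightarrow> \<theta> a \<in> \<phi> (L #> a)"
    using ex by metis
  have eqI: "\<theta> a = c" if "a \<in> carrier G" "c \<in> \<phi> (H #> a)" "c \<in> \<phi> (K #> a)" for a c
    by (rule phi_minimal_unique[OF H K ne that(1) \<theta>[OF that(1) H] \<theta>[OF that(1) K] that(2,3)])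
  have closed: "\<theta> a \<in> carrier G'" if "a \<in> carrier G" for a
    by (rule phi_r_coset_mem(1)[OF nontriv[OF H] that \<theta>[OF that H]])
  have prod: "\<theta> a \<otimes>\<^bsub>G'\<^esub> \<theta> b \<in> \<phi> (L #> (a \<otimes> b))"
    if a: "a \<in> carrier G" and b: "b \<in> carrier G" and L: "minimal_subgroup L G" for a b L
  proof -
    \<comment> \<open>The conjugate is chosen so that \<open>L a * L^a b = L a b\<close>. It is
      minimal but may differ from \<open>H\<close> and \<open>K\<close>, which is why \<theta>(b) is
      taken common to all minimal subgroups.\<close>
    let ?La = "conj_set G L a"
    have La: "minimal_subgroup ?La G" by (rule G.minimal_subgroup_conj_set[OF L a])
    have A: "L #> a \<in> K1_set G" and B: "?La #> b \<in> K1_set G"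
      by (rule G.K1_setI[OF nontriv[OF L] a], rule G.K1_setI[OF nontriv[OF La] b])
    have "K1_mult G (L #> a) (?La #> b) = L #> (a \<otimes> b)"
      using G.K1_mult_coset[OF nontriv[OF L] nontriv[OF La] a b]
      by (simp add: G.conj_set_conj_set_inv a subgroup.subset sub[OF L] G.generate_subgroup_eq)
    then have "\<phi> (L #> (a \<otimes> b)) = K1_mult G' (\<phi> (L #> a)) (\<phi> (?La #> b))"
      using phi_mult[OF A B] by simp
    then show ?thesis
      using G'.mult_mem_K1_mult[OF phi_closed[OF A] phi_closed[OF B] \<theta>[OF a L] \<theta>[OF b La]] by simp
  qed
  have hom: "\<theta> \<in> hom G G'"
  proof (rule homI)
    fix a b assume a: "a \<in> carrier G" and b: "b \<in> carrier G"
    show "\<theta> (a \<otimes> b) = \<theta> a \<otimes>\<^bsub>G'\<^esub> \<theta> b"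
      by (rule eqI[OF G.m_closed[OF a b] prod[OF a b H] prod[OF a b K]])
  qed (rule closed)
  have cos_eq: "L #> a = L #> b"
    if a: "a \<in> carrier G" and b: "b \<in> carrier G" and L: "minimal_subgroup L G"
      and eq: "\<theta> a \<in> \<phi> (L #> b)" for a b L
  proof -
    have "\<phi> (L #> a) = \<phi> (L #> b)"
      using phi_r_coset_mem(2)[OF nontriv[OF L] a \<theta>[OF a L]] phi_r_coset_mem(2)[OF nontriv[OF L] b eq]
      by simp
    then show ?thesis
      using phi_inj[OF G.K1_setI[OF nontriv[OF L] a] G.K1_setI[OF nontriv[OF L] b]] by simp
  qed
  have inj: "inj_on \<theta> (carrier G)"
  proof (rule inj_onI)
    fix a b assume a: "a \<in> carrier G" and b: "b \<in> carrier G" and eq: "\<theta> a = \<theta> b"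
    have "H #> a = H #> b" "K #> a = K #> b"
      using cos_eq[OF a b] \<theta>[OF b] eq H K by simp_all
    then show "a = b"
      using G.r_cosets_Int[OF sub[OF H] sub[OF K] G.minimal_subgroups_Int[OF H K ne] b b, of a b]
        G.rcos_self[OF a sub[OF H]] G.rcos_self[OF a sub[OF K]]
        G.rcos_self[OF b sub[OF H]] G.rcos_self[OF b sub[OF K]] by simp
  qed
  have surj: "y \<in> \<theta> ` carrier G" if y: "y \<in> carrier G'" for y
  proof -
    let ?M = "H <#> K"
    have M: "subgroup ?M G" by (rule G.subgroup_set_mult[OF sub[OF H] sub[OF K] commute[OF H K]])
    have incl: "H \<subseteq> ?M" "K \<subseteq> ?M" by (rule G.subset_set_mult[OF sub[OF H] sub[OF K]])+
    have Mn: "nontrivial_subgroup ?M G"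
      by (rule G.nontrivial_subgroup_mono[OF nontriv[OF H] M incl(1)])
    \<comment> \<open>Besides the cosets of \<open>H\<close> and \<open>K\<close>, a coset of
      \<open>?M\<close> is pulled back. It places \<open>d\<close> and \<open>e\<close> below in one
      coset of \<open>H K\<close>, as \<open>r_cosets_meet\<close> requires.\<close>
    have in_M: "d \<in> ?M #> z"
      if L: "minimal_subgroup L G" "L \<subseteq> ?M" and d: "d \<in> carrier G" "y \<in> \<phi> (L #> d)"
        and z: "z \<in> carrier G" "y \<in> \<phi> (?M #> z)" for L d z
    proof -
      have Md: "?M #> d \<in> K1_set G" and Mz: "?M #> z \<in> K1_set G" and Ld: "L #> d \<in> K1_set G"
        using G.K1_setI nontriv[OF L(1)] Mn d z by simp_all
      have "L #> d \<subseteq> ?M #> d" using L(2) by (auto simp: r_coset_def)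
      then have "y \<in> \<phi> (?M #> d)" using phi_subset_iff[OF Md Ld] d by auto
      then have "\<phi> (?M #> d) = \<phi> (?M #> z)"
        using phi_r_coset_mem(2)[OF Mn d(1)] phi_r_coset_mem(2)[OF Mn z] by simp
      then have "?M #> d = ?M #> z" using phi_inj[OF Md Mz] by simp
      then show ?thesis using G.rcos_self[OF d(1) M] by simp
    qed
    have rep: "\<exists>d\<in>carrier G. y \<in> \<phi> (L #> d)" if L: "nontrivial_subgroup L G" for L
      using r_coset_in_range_phi[OF L y] G'.rcos_self[OF y phi_subgroup[OF L]] by auto
    obtain d where d: "d \<in> carrier G" "y \<in> \<phi> (H #> d)" using rep[OF nontriv[OF H]] by blast
    obtain e where e: "e \<in> carrier G" "y \<in> \<phi> (K #> e)" using rep[OF nontriv[OF K]] by blast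
    obtain z where z: "z \<in> carrier G" "y \<in> \<phi> (?M #> z)" using rep[OF Mn] by blast
    obtain c where c: "c \<in> carrier G" "c \<in> H #> d" "c \<in> K #> e"
      using G.r_cosets_meet[OF sub[OF H] sub[OF K] commute[OF H K] d(1) e(1) z(1)
          in_M[OF H incl(1) d z] in_M[OF K incl(2) e z]] by blast
    have "H #> c = H #> d" "K #> c = K #> e"
      using G.repr_independence[OF c(2) d(1) sub[OF H]] G.repr_independence[OF c(3) e(1) sub[OF K]]
      by simp_all
    then have "\<theta> c = y" using eqI[OF c(1)] d e by simp
    then show ?thesis using c(1) by auto
  qed
  have "\<theta> \<in> iso G G'"
    using hom inj surj closed by (auto simp: iso_def bij_betw_def)
  then show ?thesis by (rule is_isoI)
qed

end

section \<open>From group isomorphisms to semigroup isomorphisms, and the equivalence\<close>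

text \<open>The isomorphism sends each coset to its image under \<open>f\<close>; taking images
  commutes with forming cosets, conjugates and generated subgroups.\<close>

lemma K1_iso_if_iso:
  assumes "group G" "group G'" "G \<cong> G'"
  shows "K1 G \<cong> K1 G'"
proof -
  obtain f where f: "f \<in> iso G G'" using assms(3) by (auto simp: is_iso_def)
  interpret G: group G by fact
  interpret G': group G' by fact
  interpret f: group_hom G G' f
    using f by (unfold_locales) (simp add: iso_def)
  have inj: "inj_on f (carrier G)" and surj: "f ` carrier G = carrier G'"
    using f by (auto simp: iso_def bij_betw_def)
  have coset: "f ` (H #>\<^bsub>G\<^esub> a) = f ` H #>\<^bsub>G'\<^esub> f a" if "H \<subseteq> carrier G" "a \<in> carrier G" for H a
    using that by (force simp: r_coset_def)
  have conj: "f ` conj_set G H a = conj_set G' (f ` H) (f a)"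
    if "H \<subseteq> carrier G" "a \<in> carrier G" for H a
  proof -
    have "f (inv\<^bsub>G\<^esub> a \<otimes>\<^bsub>G\<^esub> h \<otimes>\<^bsub>G\<^esub> a) = inv\<^bsub>G'\<^esub> f a \<otimes>\<^bsub>G'\<^esub> f h \<otimes>\<^bsub>G'\<^esub> f a" if "h \<in> H" for h
      using that \<open>H \<subseteq> carrier G\<close> \<open>a \<in> carrier G\<close> by (simp add: subset_iff)
    then show ?thesis unfolding G.conj_set_eq G'.conj_set_eq image_image by simp
  qed
  have one: "f ` {\<one>\<^bsub>G\<^esub>} = {\<one>\<^bsub>G'\<^esub>}" by simp
  have sub: "nontrivial_subgroup (f ` H) G'" if H: "nontrivial_subgroup H G" for H
  proof -
    have "f ` H \<noteq> f ` {\<one>\<^bsub>G\<^esub>}"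
      using inj_on_image_eq_iff[OF inj G.nontrivial_subgroup_carrier[OF H], of "{\<one>\<^bsub>G\<^esub>}"] H
      by (simp add: nontrivial_subgroup_def)
    then show ?thesis
      using f.subgroup_img_is_subgroup H one by (simp add: nontrivial_subgroup_def)
  qed
  have subset: "A \<subseteq> carrier G" if "A \<in> K1_set G" for A
    using that G.r_coset_subset_G[OF G.nontrivial_subgroup_carrier] by (auto elim!: G.K1_setE)
  have "image f \<in> hom (K1 G) (K1 G')"
  proof (rule homI)
    fix A assume "A \<in> carrier (K1 G)"
    then obtain H a where *: "nontrivial_subgroup H G" "a \<in> carrier G" "A = H #>\<^bsub>G\<^esub> a"
      by (auto simp: K1_def elim: G.K1_setE)
    then show "f ` A \<in> carrier (K1 G')"
      using G'.K1_setI[OF sub[OF *(1)], of "f a"] coset[OF G.nontrivial_subgroup_carrier[OF *(1)] *(2)]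
      by (simp add: K1_def)
    fix B assume "B \<in> carrier (K1 G)"
    then obtain K b where **: "nontrivial_subgroup K G" "b \<in> carrier G" "B = K #>\<^bsub>G\<^esub> b"
      by (auto simp: K1_def elim: G.K1_setE)
    note HG = G.nontrivial_subgroup_carrier[OF *(1)] and KG = G.nontrivial_subgroup_carrier[OF **(1)]
    let ?S = "H \<union> conj_set G K (inv\<^bsub>G\<^esub> a)"
    have S: "?S \<subseteq> carrier G" using HG G.conj_set_subset[OF KG, of "inv\<^bsub>G\<^esub> a"] * by simp
    have "f ` K1_mult G A B = f ` (generate G ?S #>\<^bsub>G\<^esub> (a \<otimes>\<^bsub>G\<^esub> b))"
      using G.K1_mult_coset[OF *(1) **(1) *(2) **(2)] * ** by simp
    also have "\<dots> = f ` generate G ?S #>\<^bsub>G'\<^esub> (f a \<otimes>\<^bsub>G'\<^esub> f b)"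
      using coset[OF G.generate_incl[OF S], of "a \<otimes>\<^bsub>G\<^esub> b"] * ** by simp
    also have "f ` generate G ?S = generate G' (f ` H \<union> conj_set G' (f ` K) (inv\<^bsub>G'\<^esub> f a))"
      using f.generate_img[OF S] conj[OF KG, of "inv\<^bsub>G\<^esub> a"] * by (simp add: image_Un)
    also have "\<dots> #>\<^bsub>G'\<^esub> (f a \<otimes>\<^bsub>G'\<^esub> f b) = K1_mult G' (f ` A) (f ` B)"
      using G'.K1_mult_coset[OF sub[OF *(1)] sub[OF **(1)], of "f a" "f b"] * ** coset[OF HG] coset[OF KG]
      by simp
    finally show "f ` (A \<otimes>\<^bsub>K1 G\<^esub> B) = f ` A \<otimes>\<^bsub>K1 G'\<^esub> f ` B" by (simp add: K1_def)
  qed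
  moreover have "inj_on (image f) (K1_set G)"
    using inj_on_image_eq_iff[OF inj] subset by (simp add: inj_on_def)
  moreover have "B \<in> image f ` K1_set G" if "B \<in> K1_set G'" for B
  proof -
    obtain K b where B: "nontrivial_subgroup K G'" "b \<in> carrier G'" "B = K #>\<^bsub>G'\<^esub> b"
      using \<open>B \<in> K1_set G'\<close> by (rule G'.K1_setE)
    obtain a where a: "a \<in> carrier G" "f a = b" using B(2)[folded surj] by (rule imageE) simp
    \<comment> \<open>The full preimage of \<open>K\<close>, so that \<open>f\<close> maps it onto
      \<open>K\<close>; it is non-trivial because \<open>K\<close> is.\<close>
    define H where "H = {x \<in> carrier G. f x \<in> K}"
    have HG: "H \<subseteq> carrier G" by (auto simp: H_def)
    have fH: "f ` H = K"
      using G'.nontrivial_subgroup_carrier[OF B(1), folded surj] unfolding H_def by blast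
    have "subgroup H G"
      using B(1) unfolding nontrivial_subgroup_def
      by (intro G.subgroupI) (auto simp: H_def subgroup.m_closed subgroup.m_inv_closed
          intro: subgroup.one_closed intro!: exI[of _ "\<one>\<^bsub>G\<^esub>"])
    moreover have "H \<noteq> {\<one>\<^bsub>G\<^esub>}" using B(1) fH one by (auto simp: nontrivial_subgroup_def)
    ultimately have "H #>\<^bsub>G\<^esub> a \<in> K1_set G" using a by (intro G.K1_setI) (simp_all add: nontrivial_subgroup_def)
    moreover have "f ` (H #>\<^bsub>G\<^esub> a) = B" using coset[OF HG a(1)] fH a B by simp
    ultimately show ?thesis by blast
  qed
  ultimately have "image f \<in> iso (K1 G) (K1 G')"
    by (auto simp: iso_def bij_betw_def K1_def hom_def)
  then show ?thesis by (rule is_isoI)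
qed

theorem theorem4p3:
  fixes G :: "('a, 'm) monoid_scheme"
    and G' :: "('b, 'n) monoid_scheme"
  assumes "periodic_group G"
    and "\<forall>H K. minimal_subgroup H G \<and> minimal_subgroup K G \<longrightarrow> H <#>\<^bsub>G\<^esub> K = K <#>\<^bsub>G\<^esub> H"
    and "\<exists>H K. minimal_subgroup H G \<and> minimal_subgroup K G \<and> H \<noteq> K"
    and "(\<nexists>p. p_group p G) \<or>
         (\<exists>p. p_group p G \<and> (infinite (Omega G) \<or> card (Omega G) > p ^ 2))"
    and "group G'"
  shows "K1 G \<cong> K1 G' \<longleftrightarrow> G \<cong> G'"
proof
  have G: "group G" using assms(1) by (simp add: periodic_group_def)
  show "K1 G \<cong> K1 G'" if "G \<cong> G'" by (rule K1_iso_if_iso[OF G assms(5) that])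
  assume "K1 G \<cong> K1 G'"
  then obtain \<phi> where \<phi>: "\<phi> \<in> iso (K1 G) (K1 G')" by (auto simp: is_iso_def)
  have comm: "H <#>\<^bsub>G\<^esub> K = K <#>\<^bsub>G\<^esub> H" if "minimal_subgroup H G" "minimal_subgroup K G" for H K
    using assms(2) that by blast
  interpret G: group G by (rule G)
  interpret G': group G' by (rule assms(5))
  interpret K1_iso_permuting G G' \<phi>
    by unfold_locales (fact \<phi>, fact assms(1), rule comm)
  obtain H K where HK: "minimal_subgroup H G" "minimal_subgroup K G" "H \<noteq> K" using assms(3) by blast
  show "G \<cong> G'"
  proof (rule iso_if_common_points[OF HK])
    fix a assume a: "a \<in> carrier G"
    \<comment> \<open>The point comes from the pair \<open>H\<close>, \<open>K\<close> alone. The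
      assumption on \<Omega>(G) enters through \<open>G.ex_minimal_subgroup_not_subset\<close> and
      puts \<open>c\<close> into \<phi>(L a) for every minimal \<open>L\<close>.\<close>
    obtain c where c: "c \<in> \<phi> (H #>\<^bsub>G\<^esub> a)" "c \<in> \<phi> (K #>\<^bsub>G\<^esub> a)"
      using phi_minimal_meet[OF HK a] by blast
    show "\<exists>c. \<forall>L. minimal_subgroup L G \<longrightarrow> c \<in> \<phi> (L #>\<^bsub>G\<^esub> a)"
      using phi_common_point[OF HK _ a c]
        G.ex_minimal_subgroup_not_subset[OF assms(1) comm assms(4) HK] by blast
  qed
qed

end
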